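(* Let $f:\mathbb{R}\to\mathbb{R}$ be a smooth function such that, on a small neighborhood $(-\epsilon,\epsilon)$ of $0$, $f$ is even and, for some constant $a>0$, $f(x) = -a\,x^2 + O(|x|^4)$. For $x_0>0$ and $0\le\alpha<1$ let $\tau(x_0,\alpha)$ denote the oscillation time of the solution of $\ddot{x}+2\alpha\,\dot{x}+x(1+f(x))=0$, $x(0)=x_0$, $\dot{x}(0)=0$. Then there exists $\delta>0$ such that for each fixed $x_0$ with $0<x_0<\delta$, the function $\alpha\mapsto\tau(x_0,\alpha)$, $0<\alpha<1$, reaches a positive minimum at some $\alpha$ with $0<\alpha<1$. Moreover, $$\lim_{\alpha\to1^{-}}\tau(x_0,\alpha)=\infty.$$
   Context: Consider the damped nonlinear pendulum equation $\ddot{x}+2\alpha\,\dot{x}+x(1+f(x))=0$ with viscous damping coefficient $\alpha\ge0$. For $x_0>0$ small, let $x(t)=x(t,x_0,\alpha)$, $t\ge0$, be its unique solution with $x(0)=x_0$, $\dot{x}(0)=0$; it has a local maximum at $t=0$. The oscillation time $\tau(x_0,\alpha)$ is the time at which $x$ reaches its next local maximum, i.e. the smallest $t>0$ at which $x(\cdot,x_0,\alpha)$ has a local maximum. For $\alpha=0$ it is the period of the (periodic) solution. *)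

theory Defs
  imports "HOL-Analysis.Analysis" "HOL-Library.Landau_Symbols"
begin

definition smooth :: "(real \<Rightarrow> real) \<Rightarrow> bool" where
  "smooth f \<longleftrightarrow> (\<forall>n x. ((deriv ^^ n) f) differentiable (at x))"

text \<open>
  \<open>x\<close> solves \<open>x'' + 2 \<alpha> x' + x (1 + f x) = 0\<close>, \<open>x 0 = x0\<close>, \<open>x' 0 = 0\<close> for \<open>t \<ge> 0\<close>,
  where \<open>v\<close> is the velocity \<open>x'\<close>. Values of \<open>x\<close> at negative times are unconstrained.
\<close>

definition pendulum_solution ::
    "(real \<Rightarrow> real) \<Rightarrow> real \<Rightarrow> real \<Rightarrow> (real \<Rightarrow> real) \<Rightarrow> bool" where
  "pendulum_solution f x0 \<alpha> x \<longleftrightarrow>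
     x 0 = x0 \<and>
     (\<exists>v. v 0 = 0 \<and>
       (\<forall>t\<ge>0. (x has_real_derivative v t) (at t within {0..}) \<and>
              (v has_real_derivative - (2 * \<alpha> * v t) - x t * (1 + f (x t)))
                (at t within {0..})))"

definition local_max_at :: "(real \<Rightarrow> real) \<Rightarrow> real \<Rightarrow> bool" where
  "local_max_at x t \<longleftrightarrow> (\<forall>\<^sub>F s in at t. x s \<le> x t)"

definition is_osc_time :: "(real \<Rightarrow> real) \<Rightarrow> real \<Rightarrow> real \<Rightarrow> real \<Rightarrow> bool" where
  "is_osc_time f x0 \<alpha> T \<longleftrightarrow>
     (\<exists>x. pendulum_solution f x0 \<alpha> x \<and> 0 < T \<and> local_max_at x T \<and>
          (\<forall>t. 0 < t \<and> t < T \<longrightarrow> \<not> local_max_at x t))"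

text \<open>
  The time \<open>\<tau>(x0, \<alpha>)\<close>. It is meaningful only where \<^const>\<open>is_osc_time\<close> is satisfied by
  exactly one \<open>T\<close>.
\<close>

definition osc_time :: "(real \<Rightarrow> real) \<Rightarrow> real \<Rightarrow> real \<Rightarrow> real" where
  "osc_time f x0 \<alpha> = (THE T. is_osc_time f x0 \<alpha> T)"

end

theory Submission imports Defs begin

text \<open>
  Write the equation as a system for position \<open>x\<close> and velocity \<open>v\<close> and use polar coordinates
  \<open>x = r cos \<theta>\<close>, \<open>v = - r sin \<theta>\<close>, so that
  \<open>\<theta>' = 1 - \<alpha> sin (2 \<theta>) + f x (cos \<theta>)\<^sup>2\<close>. At a multiple of \<open>\<pi>\<close> the right-hand side is
  \<open>1 + f x > 0\<close>; hence \<open>\<theta>\<close> passes each multiple of \<open>\<pi>\<close> once and upwards, and the local maxima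
  of \<open>x\<close> are the times at which \<open>\<theta>\<close> is a multiple of \<open>2 \<pi>\<close>. The oscillation time is therefore
  the unique solution of \<open>\<theta> T = 2 \<pi>\<close> (lemma \<open>motion_osc_time\<close>). Such a \<open>T\<close> exists for every
  \<open>\<alpha> < 1\<close>: when the damping is strong, \<open>\<theta>\<close> may at first be held back by the amplitude, but the
  amplitude decays and the equation becomes that of an underdamped linear oscillator.

  Three properties of \<open>\<tau>(\<alpha>)\<close> give the theorem.
  \<^item> It is continuous on \<open>[0, 1)\<close>, because \<open>\<theta>\<close> depends continuously on \<open>\<alpha>\<close> and crosses
    \<open>2 \<pi>\<close> transversally (\<open>osc_time_continuous\<close>).
  \<^item> It tends to infinity as \<open>\<alpha> \<rightarrow> 1\<close>. Since \<open>f \<le> 0\<close> near \<open>0\<close>, \<open>\<theta>' \<le> 1 - \<alpha> sin (2 \<theta>)\<close>, and this bound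
    nearly vanishes at \<open>\<theta> = \<pi>/4\<close> (\<open>osc_time_lower_bound\<close>, \<open>osc_time_at_critical_damping\<close>).
  \<^item> Some small \<open>\<alpha> > 0\<close> has \<open>\<tau>(\<alpha>) < \<tau>(0)\<close> (\<open>weak_damping_shortens_osc_time\<close>). In a softening
    spring, smaller oscillations are faster, and damping reduces the amplitude to first order in \<open>\<alpha>\<close>,
    whereas its direct effect on the frequency is only of order \<open>\<alpha>\<^sup>2\<close>.

  By the first two, \<open>\<tau>\<close> attains a minimum over \<open>[0, 1)\<close>, and by the third the minimum is not at \<open>0\<close>.

  The third property is the heart of the matter. Scale to initial amplitude \<open>1\<close>, let \<open>X\<close> and \<open>Y\<close> be the damped
  and the undamped motion and put \<open>y = exp (\<alpha> t) X\<close>. This removes the friction term: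
  \<open>y'' + (1 - \<alpha>\<^sup>2 + F X) y = 0\<close>, while \<open>Y'' + (1 + F Y) Y = 0\<close>. The Wronskian
  \<open>W = Y y' - y Y'\<close> therefore satisfies \<open>W' = (F Y - F X + \<alpha>\<^sup>2) y Y\<close>. With \<open>F X \<approx> - \<mu> X\<^sup>2\<close>,
  \<open>Y \<approx> cos t\<close> and \<open>X - Y \<approx> \<alpha> (sin t - t cos t)\<close>, the derivative is about
  \<open>2 \<mu> \<alpha> (cos t)\<^sup>3 (sin t - t cos t)\<close>, whose integral over a period is negative because of the
  secular term \<open>- t (cos t)\<^sup>4\<close>. That makes \<open>X'\<close> negative at the end of an undamped period: by
  then the damped motion has already passed its maximum (\<open>damping_advances_phase\<close>).
\<close>

section \<open>Calculus on the half-line\<close>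

lemma abs_mult_bound: "\<bar>a\<bar> \<le> A \<Longrightarrow> \<bar>b\<bar> \<le> B \<Longrightarrow> \<bar>a * b\<bar> \<le> A * B" for a b A B :: real
  unfolding abs_mult by (rule mult_mono') auto

lemma at_within_atLeast_0: "0 < (t::real) \<Longrightarrow> at t within {0..} = at t"
  by (rule at_within_interior) (simp add: interior_real_atLeast)

lemma halfline_deriv_le:
  fixes D :: "real \<Rightarrow> real"
  assumes der: "\<And>u. 0 \<le> u \<Longrightarrow> (D has_real_derivative D' u) (at u within {0..})"
    and bd: "\<And>u. s < u \<Longrightarrow> u < t \<Longrightarrow> D' u \<le> k" and st: "0 \<le> s" "s \<le> t"
  shows "D t - D s \<le> k * (t - s)"
proof (cases "s = t")
  case False
  then have lt: "s < t" using st by simp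
  have cont: "continuous_on {s..t} D"
    using der st by (intro continuous_on_subset[OF DERIV_continuous_on[of "{0..}"]]) auto
  have "(D has_real_derivative D' u) (at u)" if "s < u" for u
    using der[of u] st that by (simp add: at_within_atLeast_0)
  then have "\<And>u. s < u \<Longrightarrow> u < t \<Longrightarrow> (D has_derivative (\<lambda>h. D' u * h)) (at u)"
    by (simp add: has_field_derivative_def)
  from mvt[OF lt cont this] obtain \<xi> where "s < \<xi>" "\<xi> < t" "D t - D s = D' \<xi> * (t - s)"
    by blast
  with bd[of \<xi>] lt show ?thesis by (simp add: mult_right_mono)
qed simp

lemma halfline_deriv_ge:
  fixes D :: "real \<Rightarrow> real"
  assumes der: "\<And>u. 0 \<le> u \<Longrightarrow> (D has_real_derivative D' u) (at u within {0..})"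
    and bd: "\<And>u. s < u \<Longrightarrow> u < t \<Longrightarrow> k \<le> D' u" and st: "0 \<le> s" "s \<le> t"
  shows "k * (t - s) \<le> D t - D s"
proof -
  have "(- D t) - (- D s) \<le> (- k) * (t - s)"
    by (rule halfline_deriv_le[where D = "\<lambda>u. - D u" and D' = "\<lambda>u. - D' u"])
      (auto intro!: derivative_eq_intros der bd st)
  then show ?thesis by simp
qed

lemma halfline_deriv_abs:
  fixes D :: "real \<Rightarrow> real"
  assumes der: "\<And>u. 0 \<le> u \<Longrightarrow> (D has_real_derivative D' u) (at u within {0..})"
    and bd: "\<And>u. s < u \<Longrightarrow> u < t \<Longrightarrow> \<bar>D' u\<bar> \<le> k" and st: "0 \<le> s" "s \<le> t"
  shows "\<bar>D t - D s\<bar> \<le> k * (t - s)"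
proof -
  have "D t - D s \<le> k * (t - s)"
    by (rule halfline_deriv_le[OF der _ st]) (use bd in \<open>auto simp: abs_le_iff\<close>)
  moreover have "(- k) * (t - s) \<le> D t - D s"
    by (rule halfline_deriv_ge[OF der _ st]) (use bd in \<open>fastforce simp: abs_le_iff\<close>)+
  ultimately show ?thesis by (simp add: abs_le_iff)
qed

text \<open>
  A Gronwall estimate for three coupled quantities that start at \<open>0\<close>: the sum of their squares, plus \<open>e\<^sup>2\<close>,
  grows at most at the rate \<open>9 c\<close>. It is used for the differences of position, velocity and angle of two
  motions, where \<open>e\<close> is the difference of the damping coefficients; \<open>e = 0\<close> gives uniqueness.
\<close>

lemma gronwall_square_sum:
  fixes p q r :: "real \<Rightarrow> real"
  assumes dp: "\<And>u. 0 \<le> u \<Longrightarrow> (p has_real_derivative p' u) (at u within {0..})"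
    and dq: "\<And>u. 0 \<le> u \<Longrightarrow> (q has_real_derivative q' u) (at u within {0..})"
    and dr: "\<And>u. 0 \<le> u \<Longrightarrow> (r has_real_derivative r' u) (at u within {0..})"
    and bp: "\<And>u. 0 \<le> u \<Longrightarrow> \<bar>p' u\<bar> \<le> c * (\<bar>p u\<bar> + \<bar>q u\<bar> + \<bar>r u\<bar> + e)"
    and bq: "\<And>u. 0 \<le> u \<Longrightarrow> \<bar>q' u\<bar> \<le> c * (\<bar>p u\<bar> + \<bar>q u\<bar> + \<bar>r u\<bar> + e)"
    and br: "\<And>u. 0 \<le> u \<Longrightarrow> \<bar>r' u\<bar> \<le> c * (\<bar>p u\<bar> + \<bar>q u\<bar> + \<bar>r u\<bar> + e)"
    and init: "p 0 = 0" "q 0 = 0" "r 0 = 0" and c: "0 \<le> c" and t: "0 \<le> t"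
  shows "(p t)\<^sup>2 + (q t)\<^sup>2 + (r t)\<^sup>2 \<le> e\<^sup>2 * exp (9 * c * t)"
proof -
  define D where "D u = ((p u)\<^sup>2 + (q u)\<^sup>2 + (r u)\<^sup>2 + e\<^sup>2) * exp (- (9 * c * u))" for u
  define D' where "D' u = (2 * p u * p' u + 2 * q u * q' u + 2 * r u * r' u) * exp (- (9 * c * u))
      - 9 * c * ((p u)\<^sup>2 + (q u)\<^sup>2 + (r u)\<^sup>2 + e\<^sup>2) * exp (- (9 * c * u))" for u
  have der: "(D has_real_derivative D' u) (at u within {0..})" if "0 \<le> u" for u
    unfolding D_def D'_def
    by (rule derivative_eq_intros dp dq dr that refl | simp)+
  have le: "D' u \<le> 0" if "0 \<le> u" for u
  proof -
    have mul: "x * y \<le> \<bar>x\<bar> * B" if "\<bar>y\<bar> \<le> B" for x y B :: real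
      using mult_left_mono[OF that, of "\<bar>x\<bar>"] abs_ge_self[of "x * y"] by (simp add: abs_mult)
    define S where "S = \<bar>p u\<bar> + \<bar>q u\<bar> + \<bar>r u\<bar>"
    have "p u * p' u \<le> \<bar>p u\<bar> * (c * (S + e))" "q u * q' u \<le> \<bar>q u\<bar> * (c * (S + e))"
         "r u * r' u \<le> \<bar>r u\<bar> * (c * (S + e))"
      by (rule mul, use bp[OF that] bq[OF that] br[OF that] in \<open>simp add: S_def\<close>)+
    then have "2 * p u * p' u + 2 * q u * q' u + 2 * r u * r' u \<le> 2 * c * (S * (S + e))"
      unfolding S_def by (simp add: algebra_simps)
    also have "\<dots> \<le> 2 * c * (9/2 * ((p u)\<^sup>2 + (q u)\<^sup>2 + (r u)\<^sup>2 + e\<^sup>2))"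
    proof (intro mult_left_mono)
      have comb: "Z \<le> 9/2 * (P + E)" if "A \<le> 3 * P" "Z \<le> 3/2 * A + E/2" "0 \<le> E" for A P Z E :: real
        using that by (simp add: algebra_simps)
      have "S\<^sup>2 \<le> 3 * (\<bar>p u\<bar>\<^sup>2 + \<bar>q u\<bar>\<^sup>2 + \<bar>r u\<bar>\<^sup>2)"
        using zero_le_power2[of "\<bar>p u\<bar> - \<bar>q u\<bar>"] zero_le_power2[of "\<bar>q u\<bar> - \<bar>r u\<bar>"]
          zero_le_power2[of "\<bar>p u\<bar> - \<bar>r u\<bar>"] unfolding S_def
        by (simp add: power2_eq_square algebra_simps)
      moreover have "S * (S + e) \<le> 3/2 * S\<^sup>2 + e\<^sup>2/2"
        using zero_le_power2[of "S - e"] by (simp add: power2_eq_square algebra_simps)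
      ultimately show "S * (S + e) \<le> 9/2 * ((p u)\<^sup>2 + (q u)\<^sup>2 + (r u)\<^sup>2 + e\<^sup>2)"
        using comb[of "S\<^sup>2" "(p u)\<^sup>2 + (q u)\<^sup>2 + (r u)\<^sup>2" "S * (S + e)" "e\<^sup>2"] by simp
    qed (use c in simp)
    finally have "2 * p u * p' u + 2 * q u * q' u + 2 * r u * r' u
        - 9 * c * ((p u)\<^sup>2 + (q u)\<^sup>2 + (r u)\<^sup>2 + e\<^sup>2) \<le> 0" by (simp add: algebra_simps)
    then have "(2 * p u * p' u + 2 * q u * q' u + 2 * r u * r' u
        - 9 * c * ((p u)\<^sup>2 + (q u)\<^sup>2 + (r u)\<^sup>2 + e\<^sup>2)) * exp (- (9 * c * u)) \<le> 0"
      by (simp add: mult_nonpos_nonneg)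
    then show ?thesis unfolding D'_def by (simp add: algebra_simps)
  qed
  have "D t - D 0 \<le> 0 * (t - 0)"
    by (rule halfline_deriv_le[OF der]) (use le t in auto)
  then have "((p t)\<^sup>2 + (q t)\<^sup>2 + (r t)\<^sup>2 + e\<^sup>2) * exp (- (9 * c * t)) \<le> e\<^sup>2"
    by (simp add: D_def init)
  then have "(p t)\<^sup>2 + (q t)\<^sup>2 + (r t)\<^sup>2 + e\<^sup>2 \<le> e\<^sup>2 * exp (9 * c * t)"
    by (simp add: exp_minus field_simps)
  then show ?thesis using zero_le_power2[of e] by linarith
qed

section \<open>Global solutions of Lipschitz equations\<close>

lemma integral_exp_bound:
  fixes k :: "real \<Rightarrow> 'a::banach"
  assumes "continuous_on {0..t} k" "0 \<le> t" "0 < K" "0 \<le> B"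
    and "\<And>s. 0 \<le> s \<Longrightarrow> s \<le> t \<Longrightarrow> norm (k s) \<le> B * exp (K * s)"
  shows "norm (integral {0..t} k) \<le> B / K * exp (K * t)"
proof -
  have I: "((\<lambda>s. B * exp (K * s)) has_integral (B / K * exp (K * t) - B / K * exp (K * 0))) {0..t}"
    by (rule fundamental_theorem_of_calculus[OF assms(2)])
      (auto intro!: derivative_eq_intros simp: has_real_derivative_iff_has_vector_derivative[symmetric] \<open>0 < K\<close>[THEN less_imp_neq, symmetric])
  have "norm (integral {0..t} k) \<le> integral {0..t} (\<lambda>s. B * exp (K * s))"
    by (rule integral_norm_bound_integral)
      (use assms I in \<open>auto intro!: integrable_continuous_interval has_integral_integrable[OF I]\<close>)
  also have "\<dots> \<le> B / K * exp (K * t)" using integral_unique[OF I] assms by simp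
  finally show ?thesis .
qed

text \<open>
  The Picard operator is a contraction on all of \<open>[0, \<infinity>)\<close> at once if solutions are measured in the norm
  \<open>sup \<bar>exp (- K t) z t\<bar>\<close> with \<open>K > L\<close>: the weight turns the Lipschitz constant \<open>L\<close> into the factor
  \<open>L / K\<close>. The unknown below is \<open>u t = exp (- K t) z t\<close>, a bounded continuous function; negative times are
  handled by freezing the operator at its value at \<open>0\<close>.
\<close>

lemma lipschitz_ode_global_solution:
  fixes F :: "'a::banach \<Rightarrow> 'a"
  assumes lip: "\<And>x y. norm (F x - F y) \<le> L * norm (x - y)" and L: "0 \<le> L"
  shows "\<exists>z. z 0 = z0 \<and> (\<forall>t\<ge>0. (z has_vector_derivative F (z t)) (at t within {0..}))"
proof -
  define K where "K = 2 * L + 1"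
  have K: "0 < K" "L / K \<le> 1 / 2" using L by (auto simp: K_def field_simps)
  have cancel: "exp (- x) * (c * exp x) = c" for x c :: real
    by (simp add: exp_minus)
  have contF: "continuous_on UNIV F"
    by (rule lipschitz_on_continuous_on[of L], rule lipschitz_onI)
      (use lip L in \<open>auto simp: dist_norm\<close>)
  define k where "k u s = F (exp (K * s) *\<^sub>R apply_bcontfun u s)" for u :: "real \<Rightarrow>\<^sub>C 'a" and s
  define P where "P u t = exp (- (K * max 0 t)) *\<^sub>R (z0 + integral {0..max 0 t} (k u))" for u t
  have contk: "continuous_on S (k u)" for u S
    unfolding k_def
    by (rule continuous_on_compose2[OF contF]) (auto intro!: continuous_intros)
  have contI: "continuous_on {0..} (\<lambda>t. integral {0..t} (k u))" for u
  proof (rule continuous_on_eq_continuous_within[THEN iffD2], rule ballI)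
    fix t :: real assume t: "t \<in> {0..}"
    have "continuous_on {0..t+1} (\<lambda>t. integral {0..t} (k u))"
      by (rule indefinite_integral_continuous_1) (intro integrable_continuous_interval contk)
    then have "continuous (at t within {0..t+1}) (\<lambda>t. integral {0..t} (k u))"
      using t by (auto simp: continuous_on_eq_continuous_within)
    moreover have "at t within {0..t+1} = at t within {0..}"
      by (rule at_within_nhd[of _ "{..<t+1}"]) auto
    ultimately show "continuous (at t within {0..}) (\<lambda>t. integral {0..t} (k u))" by simp
  qed
  have contP: "continuous_on UNIV (P u)" for u
    unfolding P_def
    by (intro continuous_intros continuous_on_compose2[OF contI]) auto
  have Pbd: "norm (P u t) \<le> norm z0 + (norm (F 0) + L * norm u) / K" for u t
  proof -
    define T where "T = max 0 t"
    have T: "0 \<le> T" by (simp add: T_def)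
    have kb: "norm (k u s) \<le> (norm (F 0) + L * norm u) * exp (K * s)" if "0 \<le> s" for s
    proof -
      have "norm (k u s) \<le> norm (F 0) + norm (k u s - F 0)"
        by (rule norm_triangle_sub)
      moreover have "norm (k u s - F 0) \<le> L * norm (exp (K * s) *\<^sub>R apply_bcontfun u s)"
        using lip[of "exp (K * s) *\<^sub>R apply_bcontfun u s" 0] by (simp add: k_def)
      moreover have "\<dots> \<le> L * (exp (K * s) * norm u)"
        using L by (auto intro!: mult_left_mono norm_bounded)
      moreover have "norm (F 0) * 1 \<le> norm (F 0) * exp (K * s)"
        using K that by (intro mult_left_mono) auto
      ultimately show ?thesis by (simp add: algebra_simps)
    qed
    have "norm (integral {0..T} (k u)) \<le> (norm (F 0) + L * norm u) / K * exp (K * T)"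
      by (rule integral_exp_bound[OF contk T K(1)]) (use kb L in auto)
    then have "exp (- (K * T)) * norm (integral {0..T} (k u)) \<le>
       exp (- (K * T)) * ((norm (F 0) + L * norm u) / K * exp (K * T))"
      by (intro mult_left_mono) auto
    then have "exp (- (K * T)) * norm (integral {0..T} (k u)) \<le> (norm (F 0) + L * norm u) / K"
      unfolding cancel .
    moreover have "exp (- (K * T)) * norm z0 \<le> 1 * norm z0"
      using K(1) T by (intro mult_right_mono) simp_all
    moreover have "norm (P u t) \<le> exp (- (K * T)) * (norm z0 + norm (integral {0..T} (k u)))"
      unfolding P_def T_def[symmetric] norm_scaleR by (simp add: norm_triangle_ineq mult_left_mono)
    ultimately show ?thesis unfolding distrib_left by linarith
  qed
  have Pbc: "P u \<in> bcontfun" for u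
    by (rule bcontfun_normI[OF contP Pbd])
  define Q where "Q u = Bcontfun (P u)" for u
  have Q: "apply_bcontfun (Q u) = P u" for u
    by (simp add: Q_def Bcontfun_inverse[OF Pbc])
  have contr: "dist (Q u) (Q w) \<le> 1/2 * dist u w" for u w
  proof (rule dist_bound)
    fix t :: real
    define T where "T = max 0 t"
    have T: "0 \<le> T" by (simp add: T_def)
    have kb: "norm (k u s - k w s) \<le> (L * dist u w) * exp (K * s)" for s
    proof -
      have "norm (k u s - k w s) \<le> L * norm (exp (K * s) *\<^sub>R (apply_bcontfun u s - apply_bcontfun w s))"
        unfolding k_def using lip by (simp add: scaleR_diff_right)
      also have "\<dots> \<le> L * (exp (K * s) * dist u w)"
        using L dist_bounded[of u s w] by (auto intro!: mult_left_mono simp: dist_norm)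
      finally show ?thesis by (simp add: algebra_simps)
    qed
    have "norm (integral {0..T} (\<lambda>s. k u s - k w s)) \<le> (L * dist u w) / K * exp (K * T)"
      by (rule integral_exp_bound[OF _ T K(1)]) (use kb L in \<open>auto intro!: continuous_intros contk\<close>)
    then have "exp (- (K * T)) * norm (integral {0..T} (\<lambda>s. k u s - k w s)) \<le>
       exp (- (K * T)) * ((L * dist u w) / K * exp (K * T))"
      by (intro mult_left_mono) auto
    also have "\<dots> = L / K * dist u w" unfolding cancel by simp
    also have "\<dots> \<le> 1/2 * dist u w" using K by (intro mult_right_mono) auto
    finally have *: "exp (- (K * T)) * norm (integral {0..T} (\<lambda>s. k u s - k w s)) \<le> 1/2 * dist u w" .
    have "dist (P u t) (P w t) = exp (- (K * T)) * norm (integral {0..T} (k u) - integral {0..T} (k w))"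
      unfolding P_def T_def[symmetric] dist_norm scaleR_diff_right[symmetric] norm_scaleR by simp
    also have "integral {0..T} (k u) - integral {0..T} (k w) = integral {0..T} (\<lambda>s. k u s - k w s)"
      by (rule Henstock_Kurzweil_Integration.integral_diff[symmetric]) (intro integrable_continuous_interval contk)+
    finally show "dist (apply_bcontfun (Q u) t) (apply_bcontfun (Q w) t) \<le> 1/2 * dist u w"
      using * by (simp add: Q)
  qed
  have "\<exists>!u. Q u = u"
    using contr by (intro banach_fix_type[of "1/2"]) auto
  then obtain u where u: "Q u = u" by blast
  define z where "z t = exp (K * t) *\<^sub>R apply_bcontfun u t" for t
  have zI: "z t = z0 + integral {0..t} (\<lambda>s. F (z s))" if "0 \<le> t" for t
  proof -
    have "z t = exp (K * t) *\<^sub>R P u t" by (metis Q u z_def)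
    also have "\<dots> = z0 + integral {0..t} (k u)"
      using that by (simp add: P_def max_def exp_minus)
    finally show ?thesis by (simp add: k_def[abs_def] z_def[symmetric])
  qed
  have contz: "continuous_on S (\<lambda>s. F (z s))" for S
    unfolding z_def by (rule continuous_on_compose2[OF contF]) (auto intro!: continuous_intros)
  have "(z has_vector_derivative F (z t)) (at t within {0..})" if "0 \<le> t" for t
  proof -
    have "((\<lambda>t. integral {0..t} (\<lambda>s. F (z s))) has_vector_derivative F (z t)) (at t within {0..t+1})"
      by (rule integral_has_vector_derivative[OF contz]) (use that in auto)
    moreover have "at t within {0..t+1} = at t within {0..}"
      by (rule at_within_nhd[of _ "{..<t+1}"]) (use that in auto)
    ultimately have I: "((\<lambda>t. integral {0..t} (\<lambda>s. F (z s))) has_vector_derivative F (z t)) (at t within {0..})"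
      by metis
    show ?thesis
    proof (rule has_vector_derivative_transform[where f = "\<lambda>t. z0 + integral {0..t} (\<lambda>s. F (z s))"])
      show "((\<lambda>t. z0 + integral {0..t} (\<lambda>s. F (z s))) has_vector_derivative F (z t)) (at t within {0..})"
        using has_vector_derivative_add[OF has_vector_derivative_const I] by simp
    qed (use that zI in auto)
  qed
  moreover have "z 0 = z0" using zI[of 0] by simp
  ultimately show ?thesis by blast
qed

section \<open>Energy and polar angle\<close>

lemma continuous_on_halfline:
  assumes "\<And>u. 0 \<le> u \<Longrightarrow> (\<theta> has_real_derivative \<theta>' u) (at u within {0..})"
  shows "continuous_on {0..} \<theta>"
  by (rule DERIV_continuous_on) (use assms in auto)

text \<open>
  If the derivative is positive wherever the value is \<open>c\<close>, then \<open>c\<close> can only be crossed upwards. At a first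
  return to \<open>c\<close> from above, the function would have to be below \<open>c\<close> just before.
\<close>

lemma upcrossing_stays_above:
  fixes \<theta> :: "real \<Rightarrow> real"
  assumes der: "\<And>u. 0 \<le> u \<Longrightarrow> (\<theta> has_real_derivative \<theta>' u) (at u within {0..})"
    and pos: "\<And>u. 0 \<le> u \<Longrightarrow> \<theta> u = c \<Longrightarrow> 0 < \<theta>' u"
    and s: "0 \<le> s" "c \<le> \<theta> s" and st: "s < t"
  shows "c < \<theta> t"
proof (rule ccontr)
  assume "\<not> c < \<theta> t"
  have cont: "continuous_on {0..} \<theta>" by (rule continuous_on_halfline[OF der])
  obtain s' where s': "s \<le> s'" "s' < t" "c < \<theta> s'"
  proof (cases "c < \<theta> s")
    case True
    then show ?thesis using that st by blast
  next
    case False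
    then have eq: "\<theta> s = c" using s by simp
    from has_real_derivative_pos_inc_right[OF der[OF s(1)] pos[OF s(1) eq]]
    obtain d where d: "d > 0" "\<And>h. 0 < h \<Longrightarrow> s + h \<in> {0..} \<Longrightarrow> h < d \<Longrightarrow> \<theta> s < \<theta> (s + h)"
      by blast
    define h where "h = min (d/2) ((t - s)/2)"
    have "0 < h" "h < d" "s + h < t" using d st by (auto simp: h_def min_def field_simps)
    then show ?thesis using d(2)[of h] s eq that[of "s + h"] by auto
  qed
  let ?Z = "{s'..t} \<inter> \<theta> -` {..c}"
  have "continuous_on {s'..t} \<theta>" using s s' by (intro continuous_on_subset[OF cont]) auto
  then have "closed ?Z" by (intro continuous_closed_preimage) auto
  moreover have "bounded ?Z" by (rule bounded_subset[of "{s'..t}"]) auto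
  ultimately have "compact ?Z" by (simp add: compact_eq_bounded_closed)
  moreover have "t \<in> ?Z" using \<open>\<not> c < \<theta> t\<close> s' by simp
  ultimately obtain u where u: "u \<in> ?Z" "\<And>w. w \<in> ?Z \<Longrightarrow> u \<le> w"
    using compact_attains_inf[of ?Z] by blast
  have "u \<noteq> s'" using u(1) s'(3) by auto
  then have u0: "s' < u" "0 < u" using u(1) s' s by auto
  have above: "c < \<theta> w" if "s' \<le> w" "w < u" for w
    using u(2)[of w] u(1) that by (cases "\<theta> w \<le> c") auto
  have du: "(\<theta> has_real_derivative \<theta>' u) (at u)"
    using der[of u] u0 by (simp add: at_within_atLeast_0)
  have "c \<le> \<theta> u"
  proof (rule tendsto_lowerbound[of \<theta> "\<theta> u" "at_left u"])
    show "(\<theta> \<longlongrightarrow> \<theta> u) (at_left u)"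
      using DERIV_isCont[OF du] by (simp add: isCont_def filterlim_at_split)
    show "\<forall>\<^sub>F w in at_left u. c \<le> \<theta> w"
      using eventually_at_left_real[OF u0(1)] by eventually_elim (auto intro!: less_imp_le above)
  qed simp
  with u(1) have eq: "\<theta> u = c" by simp
  with pos[of u] u0 have "0 < \<theta>' u" by simp
  from DERIV_pos_inc_left[OF du this] obtain d where d: "d > 0" "\<And>h. 0 < h \<Longrightarrow> h < d \<Longrightarrow> \<theta> (u - h) < \<theta> u"
    by blast
  define h where "h = min (d/2) ((u - s')/2)"
  have "0 < h" "h < d" "s' < u - h" using d u0 by (auto simp: h_def min_def field_simps)
  then show False using d(2)[of h] above[of "u - h"] eq by auto
qed

lemma antiderivative_exists:
  fixes k :: "real \<Rightarrow> real"
  assumes "continuous_on UNIV k"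
  shows "\<exists>K. K 0 = 0 \<and> (\<forall>t. (K has_real_derivative k t) (at t))"
proof -
  have "\<exists>K. \<forall>x::real. -\<infinity> < ereal x \<longrightarrow> ereal x < \<infinity> \<longrightarrow> (K has_vector_derivative k x) (at x)"
    by (rule einterval_antiderivative) (use assms in \<open>auto simp: continuous_on_eq_continuous_at\<close>)
  then obtain K where K: "\<And>x. (K has_real_derivative k x) (at x)"
    by (auto simp: has_real_derivative_iff_has_vector_derivative)
  show ?thesis
    by (rule exI[of _ "\<lambda>x. K x - K 0"]) (auto intro!: derivative_eq_intros K)
qed

lemma halfline_antiderivative_exists:
  fixes k :: "real \<Rightarrow> real"
  assumes "continuous_on {0..} k"
  shows "\<exists>K. K 0 = 0 \<and> (\<forall>t\<ge>0. (K has_real_derivative k t) (at t within {0..}))"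
proof -
  have "continuous_on UNIV (\<lambda>t. k (max 0 t))"
    by (rule continuous_on_compose2[OF assms]) (auto intro!: continuous_intros)
  from antiderivative_exists[OF this] obtain K where "K 0 = 0"
    and K: "\<And>t. (K has_real_derivative k (max 0 t)) (at t)" by blast
  moreover have "(K has_real_derivative k t) (at t within {0..})" if "0 \<le> t" for t
    using has_field_derivative_at_within[OF K[of t], of "{0..}"] that by (simp add: max_def)
  ultimately show ?thesis by blast
qed

text \<open>
  The energy \<open>v\<^sup>2 / 2 + V x\<close> with \<open>V' = g\<close> does not increase. To leave \<open>[-b, b]\<close>, the motion would have to
  reach some \<open>\<plusminus> c\<close> with \<open>b < c < \<delta>\<close>, where \<open>V\<close> exceeds its value at \<open>b\<close>; oddness of \<open>g\<close> makes \<open>V\<close> even and so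
  treats both sides alike. As \<open>V\<close> is defined and the energy does not increase anywhere, the argument applies to
  solutions that are not known in advance to stay near \<open>0\<close>. The velocity bound is uniform in \<open>\<alpha>\<close> for
  the sake of \<open>motion_lipschitz_in_damping\<close>.
\<close>

lemma energy_confinement:
  fixes g x v :: "real \<Rightarrow> real"
  assumes g: "continuous_on UNIV g"
    and odd: "\<And>y. \<bar>y\<bar> < \<delta> \<Longrightarrow> g (- y) = - g y"
    and pos: "\<And>y. 0 < y \<Longrightarrow> y < \<delta> \<Longrightarrow> 0 < g y"
    and b: "0 < b" "b < \<delta>"
  shows "\<exists>M. \<forall>\<alpha> x v t. 0 \<le> \<alpha> \<longrightarrow> x 0 = b \<longrightarrow> v 0 = 0 \<longrightarrow>
     (\<forall>t\<ge>0. (x has_real_derivative v t) (at t within {0..}) \<and>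
            (v has_real_derivative - (2 * \<alpha> * v t) - g (x t)) (at t within {0..})) \<longrightarrow>
     0 \<le> t \<longrightarrow> \<bar>x t\<bar> \<le> b \<and> \<bar>v t\<bar> \<le> M"
proof -
  obtain V where V0: "V 0 = 0" and V: "\<And>y. (V has_real_derivative g y) (at y)"
    using antiderivative_exists[OF g] by blast
  have inc: "V y < V z" if "0 \<le> y" "y < z" "z < \<delta>" for y z
  proof (rule DERIV_pos_imp_increasing_open[OF that(2)])
    show "continuous_on {y..z} V"
      using V by (meson DERIV_continuous_on has_field_derivative_at_within)
    show "\<exists>l. (V has_real_derivative l) (at w) \<and> 0 < l" if "y < w" "w < z" for w
      using V[of w] pos[of w] that \<open>0 \<le> y\<close> \<open>z < \<delta>\<close> by auto
  qed
  have even: "V (- y) = V y" if y: "0 \<le> y" "y < \<delta>" for y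
  proof (cases "y = 0")
    case False
    have "V (- y) - V y = V (- 0) - V 0"
    proof (rule DERIV_isconst_end[where f = "\<lambda>w. V (- w) - V w"])
      show "0 < y" using False y by simp
      show "continuous_on {0..y} (\<lambda>w. V (- w) - V w)"
        by (rule DERIV_continuous_on[where D = "\<lambda>w. - g (- w) - g w"])
          (auto intro!: derivative_eq_intros DERIV_chain'[OF _ V] has_field_derivative_at_within[OF V])
      show "((\<lambda>w. V (- w) - V w) has_real_derivative 0) (at w)" if "0 < w" "w < y" for w
        using odd[of w] that y by (auto intro!: derivative_eq_intros DERIV_chain'[OF _ V] V)
    qed
    then show ?thesis using V0 by simp
  qed simp
  have main: "\<bar>x t\<bar> \<le> b \<and> \<bar>v t\<bar> \<le> sqrt (2 * V b)"
    if al: "0 \<le> \<alpha>" and init: "x 0 = b" "v 0 = 0"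
      and dx: "\<And>t. 0 \<le> t \<Longrightarrow> (x has_real_derivative v t) (at t within {0..})"
      and dv: "\<And>t. 0 \<le> t \<Longrightarrow> (v has_real_derivative - (2 * \<alpha> * v t) - g (x t)) (at t within {0..})"
      and t: "0 \<le> t" for \<alpha> x v t
  proof -
    have E: "(v s)\<^sup>2 / 2 + V (x s) \<le> V b" if s: "0 \<le> s" for s
    proof -
      have "(v s)\<^sup>2 / 2 + V (x s) - ((v 0)\<^sup>2 / 2 + V (x 0)) \<le> 0 * (s - 0)"
      proof (rule halfline_deriv_le[where D = "\<lambda>s. (v s)\<^sup>2 / 2 + V (x s)"])
        show "((\<lambda>s. (v s)\<^sup>2 / 2 + V (x s)) has_real_derivative - (2 * \<alpha> * (v u)\<^sup>2)) (at u within {0..})"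
          if "0 \<le> u" for u
          by (rule derivative_eq_intros DERIV_chain'[OF _ V] dx dv that refl | simp)+
            (simp add: power2_eq_square algebra_simps)
      qed (use al s in auto)
      then show ?thesis by (simp add: init)
    qed
    have confined: "\<bar>x s\<bar> \<le> b" if s: "0 \<le> s" for s
    proof (rule ccontr)
      assume "\<not> \<bar>x s\<bar> \<le> b"
      define c where "c = min ((b + \<delta>) / 2) \<bar>x s\<bar>"
      have c: "b < c" "c < \<delta>" "c \<le> \<bar>x s\<bar>"
        using b \<open>\<not> \<bar>x s\<bar> \<le> b\<close> by (auto simp: c_def min_def)
      have "continuous_on {0..s} (\<lambda>u. \<bar>x u\<bar>)"
        by (intro continuous_intros continuous_on_subset[OF continuous_on_halfline[OF dx]]) auto
      then obtain u where u: "0 \<le> u" "u \<le> s" "\<bar>x u\<bar> = c"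
        using IVT'[of "\<lambda>u. \<bar>x u\<bar>" 0 c s] c s b init by auto
      have "V (x u) = V c"
        using u(3) even[of c] c b by (cases "x u < 0") auto
      moreover have "V b < V c" using inc[of b c] b c by simp
      ultimately show False using E[OF u(1)] zero_le_power2[of "v u"] by linarith
    qed
    have "0 \<le> V (x t)"
    proof -
      have "V \<bar>x t\<bar> = V (x t)"
        using even[of "\<bar>x t\<bar>"] confined[OF t] b by (cases "x t < 0") auto
      moreover have "0 \<le> V \<bar>x t\<bar>"
        using inc[of 0 "\<bar>x t\<bar>"] confined[OF t] b V0 by (cases "x t = 0") auto
      ultimately show ?thesis by simp
    qed
    then have "(v t)\<^sup>2 \<le> 2 * V b" using E[OF t] by simp
    then have "sqrt ((v t)\<^sup>2) \<le> sqrt (2 * V b)" by (rule real_sqrt_le_mono)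
    then show ?thesis using confined[OF t] by simp
  qed
  show ?thesis
    by (rule exI[of _ "sqrt (2 * V b)"]) (use main in blast)
qed

text \<open>
  The angle is defined as the integral of the angular velocity
  \<open>(v\<^sup>2 + 2 \<alpha> v x + x\<^sup>2 (1 + q)) / (x\<^sup>2 + v\<^sup>2)\<close>. The denominator never vanishes, since
  \<open>x\<^sup>2 + v\<^sup>2\<close> decays at most exponentially. The unit vector \<open>(x, - v) / r\<close>, rotated back by this angle,
  has derivative \<open>0\<close>, so it stays at its initial value.
\<close>

lemma polar_angle_exists:
  fixes x v :: "real \<Rightarrow> real"
  assumes dx: "\<And>t. 0 \<le> t \<Longrightarrow> (x has_real_derivative v t) (at t within {0..})"
    and dv: "\<And>t. 0 \<le> t \<Longrightarrow> (v has_real_derivative - (2 * \<alpha> * v t) - x t * (1 + q t)) (at t within {0..})"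
    and q: "continuous_on {0..} q" "\<And>t. 0 \<le> t \<Longrightarrow> \<bar>q t\<bar> \<le> 1" and al: "0 \<le> \<alpha>" "\<alpha> \<le> 1"
    and init: "0 < x 0" "v 0 = 0"
  shows "\<exists>\<theta>. \<theta> 0 = 0 \<and> (\<forall>t\<ge>0. x t \<noteq> 0 \<or> v t \<noteq> 0) \<and>
    (\<forall>t\<ge>0. x t = sqrt ((x t)\<^sup>2 + (v t)\<^sup>2) * cos (\<theta> t) \<and> v t = - (sqrt ((x t)\<^sup>2 + (v t)\<^sup>2) * sin (\<theta> t)) \<and>
     (\<theta> has_real_derivative 1 - \<alpha> * sin (2 * \<theta> t) + q t * (cos (\<theta> t))\<^sup>2) (at t within {0..}))"
proof -
  define N where "N t = (x t)\<^sup>2 + (v t)\<^sup>2" for t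
  define N' where "N' t = 2 * x t * v t + 2 * v t * (- (2 * \<alpha> * v t) - x t * (1 + q t))" for t
  have dN: "(N has_real_derivative N' t) (at t within {0..})" if "0 \<le> t" for t
    unfolding N_def[abs_def] N'_def
    by (rule derivative_eq_intros dx dv that refl | simp)+
  have Npos: "0 < N t" if t: "0 \<le> t" for t
  proof -
    have "0 * (t - 0) \<le> N t * exp (5 * t) - N 0 * exp (5 * 0)"
    proof (rule halfline_deriv_ge[where D = "\<lambda>t. N t * exp (5 * t)"])
      show "((\<lambda>t. N t * exp (5 * t)) has_real_derivative (N' u + 5 * N u) * exp (5 * u)) (at u within {0..})"
        if "0 \<le> u" for u
        by (rule derivative_eq_intros dN that refl | simp)+ (simp add: algebra_simps)
      show "0 \<le> (N' u + 5 * N u) * exp (5 * u)" if "0 < u" for u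
      proof -
        have "N' u + 5 * N u = 4 * (1 - \<alpha>) * (v u)\<^sup>2 + (v u)\<^sup>2 + 5 * (x u)\<^sup>2 - 2 * (x u * v u) * q u"
          by (simp add: N_def N'_def power2_eq_square algebra_simps)
        moreover have "2 * (x u * v u) * q u \<le> (v u)\<^sup>2 + (x u)\<^sup>2"
        proof -
          have "2 * (x u * v u) * q u \<le> \<bar>2 * (x u * v u)\<bar> * \<bar>q u\<bar>"
            by (metis abs_ge_self abs_mult)
          also have "\<dots> \<le> \<bar>2 * (x u * v u)\<bar> * 1"
            using q(2)[of u] that by (intro mult_left_mono) auto
          also have "\<dots> \<le> (v u)\<^sup>2 + (x u)\<^sup>2"
            using zero_le_power2[of "\<bar>v u\<bar> - \<bar>x u\<bar>"] unfolding power2_diff by (simp add: abs_mult algebra_simps)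
          finally show ?thesis .
        qed
        moreover have "0 \<le> 4 * (1 - \<alpha>) * (v u)\<^sup>2" using al by simp
        ultimately have "0 \<le> N' u + 5 * N u" using zero_le_power2[of "x u"] by linarith
        then show ?thesis by simp
      qed
    qed (use t in auto)
    then have "N 0 \<le> N t * exp (5 * t)" by simp
    moreover have "0 < N 0" using init by (simp add: N_def)
    ultimately show ?thesis by (smt (verit) exp_gt_zero mult_nonpos_nonneg)
  qed
  define k where "k t = ((v t)\<^sup>2 + 2 * \<alpha> * v t * x t + (x t)\<^sup>2 * (1 + q t)) / N t" for t
  have cx: "continuous_on {0..} x" and cv: "continuous_on {0..} v"
    by (rule continuous_on_halfline, fact dx, rule continuous_on_halfline, fact dv)
  have "continuous_on {0..} k"
    unfolding k_def using Npos by (auto intro!: continuous_intros cx cv q simp: N_def) (force simp: N_def)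
  from halfline_antiderivative_exists[OF this] obtain \<theta> where th0: "\<theta> 0 = 0"
    and dth: "\<And>t. 0 \<le> t \<Longrightarrow> (\<theta> has_real_derivative k t) (at t within {0..})" by blast
  define r where "r t = sqrt (N t)" for t
  define r' where "r' t = N' t / (2 * r t)" for t
  have rpos: "0 < r t" and r2: "r t * r t = N t" if "0 \<le> t" for t
    using Npos[OF that] by (auto simp: r_def)
  have dr: "(r has_real_derivative r' t) (at t within {0..})" if "0 \<le> t" for t
    using DERIV_chain'[OF dN[OF that] DERIV_real_sqrt[OF Npos[OF that]]]
    by (simp add: r_def[abs_def] r'_def field_simps)
  \<comment> \<open>\<open>(C, S)\<close> is the vector \<open>(x, - v) / r\<close> rotated back by \<open>\<theta>\<close>, up to the sign of \<open>S\<close>.\<close>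
  define C where "C t = (x t * cos (\<theta> t) - v t * sin (\<theta> t)) / r t" for t
  define S where "S t = (x t * sin (\<theta> t) + v t * cos (\<theta> t)) / r t" for t
  have key: "(v t - x t * (r' t / r t) - v t * k t) = 0"
       "(- (2 * \<alpha> * v t) - x t * (1 + q t) - v t * (r' t / r t) + x t * k t) = 0" if t: "0 \<le> t" for t
  proof -
    have rr: "r' t / r t = N' t / (2 * N t)" using r2[OF t] rpos[OF t] by (simp add: r'_def field_simps)
    show "(v t - x t * (r' t / r t) - v t * k t) = 0"
      unfolding rr k_def using Npos[OF t] by (simp add: field_simps) (simp add: N_def N'_def power2_eq_square algebra_simps)
    show "(- (2 * \<alpha> * v t) - x t * (1 + q t) - v t * (r' t / r t) + x t * k t) = 0"
      unfolding rr k_def using Npos[OF t] by (simp add: field_simps) (simp add: N_def N'_def power2_eq_square algebra_simps)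
  qed
  have dC: "(C has_real_derivative 0) (at t within {0..})" if t: "0 \<le> t" for t
  proof -
    have num: "((\<lambda>t. (x t * cos (\<theta> t) - v t * sin (\<theta> t))) has_real_derivative
      (v t * cos (\<theta> t) - x t * (sin (\<theta> t) * k t)) - ((- (2 * \<alpha> * v t) - x t * (1 + q t)) * sin (\<theta> t) + v t * (cos (\<theta> t) * k t))) (at t within {0..})"
      by (rule derivative_eq_intros dx dv dth t refl)+ simp
    have "(C has_real_derivative ((v t - x t * (r' t / r t) - v t * k t) * cos (\<theta> t) -
       (- (2 * \<alpha> * v t) - x t * (1 + q t) - v t * (r' t / r t) + x t * k t) * sin (\<theta> t)) / r t) (at t within {0..})"
      unfolding C_def[abs_def]
      by (rule DERIV_cong[OF DERIV_divide[OF num dr[OF t]]])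
        (use rpos[OF t] in \<open>simp_all add: field_simps\<close>)
    then show ?thesis unfolding key[OF t] by simp
  qed
  have dS: "(S has_real_derivative 0) (at t within {0..})" if t: "0 \<le> t" for t
  proof -
    have num: "((\<lambda>t. (x t * sin (\<theta> t) + v t * cos (\<theta> t))) has_real_derivative
      (v t * sin (\<theta> t) + x t * (cos (\<theta> t) * k t)) + ((- (2 * \<alpha> * v t) - x t * (1 + q t)) * cos (\<theta> t) - v t * (sin (\<theta> t) * k t))) (at t within {0..})"
      by (rule derivative_eq_intros dx dv dth t refl)+ simp
    have "(S has_real_derivative ((v t - x t * (r' t / r t) - v t * k t) * sin (\<theta> t) +
       (- (2 * \<alpha> * v t) - x t * (1 + q t) - v t * (r' t / r t) + x t * k t) * cos (\<theta> t)) / r t) (at t within {0..})"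
      unfolding S_def[abs_def]
      by (rule DERIV_cong[OF DERIV_divide[OF num dr[OF t]]])
        (use rpos[OF t] in \<open>simp_all add: field_simps\<close>)
    then show ?thesis unfolding key[OF t] by simp
  qed
  have C1: "C t = 1" if t: "0 \<le> t" for t
  proof -
    have "\<bar>C t - C 0\<bar> \<le> 0 * (t - 0)" by (rule halfline_deriv_abs[OF dC]) (use t in auto)
    moreover have "C 0 = 1" using init by (simp add: C_def th0 r_def N_def)
    ultimately show ?thesis by simp
  qed
  have S0: "S t = 0" if t: "0 \<le> t" for t
  proof -
    have "\<bar>S t - S 0\<bar> \<le> 0 * (t - 0)" by (rule halfline_deriv_abs[OF dS]) (use t in auto)
    moreover have "S 0 = 0" using init by (simp add: S_def th0)
    ultimately show ?thesis by simp
  qed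
  have pol: "x t = r t * cos (\<theta> t)" "v t = - (r t * sin (\<theta> t))" if t: "0 \<le> t" for t
  proof -
    have e: "x t * cos (\<theta> t) - v t * sin (\<theta> t) = r t" "x t * sin (\<theta> t) + v t * cos (\<theta> t) = 0"
      using C1[OF t] S0[OF t] rpos[OF t] by (auto simp: C_def S_def)
    have sc: "sin (\<theta> t) * sin (\<theta> t) + cos (\<theta> t) * cos (\<theta> t) = 1"
      using sin_cos_squared_add[of "\<theta> t"] by (simp add: power2_eq_square)
    have alg: "X * (s * s + c * c) = (X * c - V * s) * c + (X * s + V * c) * s"
         "V * (s * s + c * c) = (X * s + V * c) * c - (X * c - V * s) * s" for X V s c :: real
      by (simp_all add: algebra_simps)
    show "x t = r t * cos (\<theta> t)"
      using alg(1)[where X = "x t" and s = "sin (\<theta> t)" and c = "cos (\<theta> t)" and V = "v t"] unfolding e sc by simp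
    show "v t = - (r t * sin (\<theta> t))"
      using alg(2)[where X = "x t" and s = "sin (\<theta> t)" and c = "cos (\<theta> t)" and V = "v t"] unfolding e sc by simp
  qed
  have k: "k t = 1 - \<alpha> * sin (2 * \<theta> t) + q t * (cos (\<theta> t))\<^sup>2" if t: "0 \<le> t" for t
  proof -
    let ?s = "sin (\<theta> t)" and ?c = "cos (\<theta> t)"
    have alg: "(- (R * s))\<^sup>2 + 2 * \<alpha> * (- (R * s)) * (R * c) + (R * c)\<^sup>2 * (1 + Q) =
       (R * R) * ((s\<^sup>2 + c\<^sup>2) - 2 * \<alpha> * s * c + Q * c\<^sup>2)" for R s c Q :: real
      by (simp add: power2_eq_square algebra_simps)
    have "(v t)\<^sup>2 + 2 * \<alpha> * v t * x t + (x t)\<^sup>2 * (1 + q t) = N t * (1 - 2 * \<alpha> * ?s * ?c + q t * ?c\<^sup>2)"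
      using alg[of "r t" ?s ?c "q t"] unfolding pol[OF t, symmetric] r2[OF t] by simp
    then show ?thesis unfolding k_def sin_double using Npos[OF t] by (simp add: mult_ac)
  qed
  have r_alt: "sqrt ((x t)\<^sup>2 + (v t)\<^sup>2) = r t" for t by (simp add: r_def N_def)
  show ?thesis unfolding r_alt
  proof (intro exI[of _ \<theta>] conjI allI impI)
    fix t :: real assume t: "0 \<le> t"
    show "x t \<noteq> 0 \<or> v t \<noteq> 0" using Npos[OF t] by (auto simp: N_def)
    show "x t = r t * cos (\<theta> t)" "v t = - (r t * sin (\<theta> t))" by (fact pol[OF t])+
    show "(\<theta> has_real_derivative 1 - \<alpha> * sin (2 * \<theta> t) + q t * (cos (\<theta> t))\<^sup>2) (at t within {0..})"
      using dth[OF t] unfolding k[OF t] .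
  qed (rule th0)
qed

section \<open>Motions of a softening spring\<close>

lemma abs_sin_diff_le: "\<bar>sin x - sin y\<bar> \<le> \<bar>x - y\<bar>" for x y :: real
proof -
  have "\<bar>sin x - sin y\<bar> = 2 * \<bar>sin ((x - y) / 2)\<bar> * \<bar>cos ((x + y) / 2)\<bar>"
    by (simp add: sin_diff_sin abs_mult)
  also have "\<dots> \<le> 2 * \<bar>(x - y) / 2\<bar> * 1"
    by (intro mult_mono abs_sin_x_le_abs_x mult_left_mono) auto
  finally show ?thesis by simp
qed

lemma abs_cos_square_diff_le: "\<bar>(cos x)\<^sup>2 - (cos y)\<^sup>2\<bar> \<le> \<bar>x - y\<bar>" for x y :: real
proof -
  have "\<bar>(cos x)\<^sup>2 - (cos y)\<^sup>2\<bar> = \<bar>sin (pi/2 + 2 * x) - sin (pi/2 + 2 * y)\<bar> / 2"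
  proof -
    have half: "(cos z)\<^sup>2 = (1 + sin (pi/2 + 2 * z)) / 2" for z :: real
      by (simp add: sin_add cos_double_cos)
    show ?thesis unfolding half[of x] half[of y] by (simp add: diff_divide_distrib[symmetric])
  qed
  also have "\<dots> \<le> \<bar>x - y\<bar>"
  proof -
    have "\<bar>(pi/2 + 2 * x) - (pi/2 + 2 * y)\<bar> = 2 * \<bar>x - y\<bar>" by (simp add: abs_if)
    then show ?thesis using abs_sin_diff_le[of "pi/2 + 2 * x" "pi/2 + 2 * y"] by simp
  qed
  finally show ?thesis .
qed

text \<open>
  The solution with initial amplitude \<open>b\<close> together with its velocity \<open>v\<close> and a continuous polar angle \<open>\<theta>\<close> of
  \<open>(x, - v)\<close>; with this sign the rotation is in the direction of increasing \<open>\<theta>\<close>.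
\<close>

definition pendulum_motion where
  "pendulum_motion f b \<alpha> x v \<theta> \<longleftrightarrow> x 0 = b \<and> v 0 = 0 \<and> \<theta> 0 = (0::real) \<and>
    (\<forall>t\<ge>0. (x has_real_derivative v t) (at t within {0..}) \<and>
       (v has_real_derivative - (2 * \<alpha> * v t) - x t * (1 + f (x t))) (at t within {0..}) \<and>
       (\<theta> has_real_derivative 1 - \<alpha> * sin (2 * \<theta> t) + f (x t) * (cos (\<theta> t))\<^sup>2) (at t within {0..}) \<and>
       \<bar>x t\<bar> \<le> b \<and> (x t \<noteq> 0 \<or> v t \<noteq> 0) \<and>
       x t = sqrt ((x t)\<^sup>2 + (v t)\<^sup>2) * cos (\<theta> t) \<and>
       v t = - (sqrt ((x t)\<^sup>2 + (v t)\<^sup>2) * sin (\<theta> t)))"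

text \<open>
  The last assumption says that \<open>f x + a x\<^sup>2\<close> has a Lipschitz constant on \<open>[-b, b]\<close> that is
  small compared with that of \<open>a x\<^sup>2\<close>. Closeness of values would not do: the comparison of the damped with the
  undamped motion needs differences of \<open>f\<close> at two nearby points to be those of \<open>- a x\<^sup>2\<close> up to a small
  relative error. The value \<open>1 / 1000000\<close> leaves room for the error constants of
  \<open>damping_advances_phase\<close>.
\<close>

locale softening_spring =
  fixes f :: "real \<Rightarrow> real" and a \<eta> \<delta> :: real
  assumes a_pos: "0 < a" and eta: "0 < \<eta>" "\<eta> \<le> 1 / 1000000" and delta_pos: "0 < \<delta>"
    and a_delta: "a * \<delta>\<^sup>2 \<le> \<eta>"
    and f_zero: "f 0 = 0" and f_cont: "continuous_on UNIV f"
    and f_even: "\<And>x. \<bar>x\<bar> < \<delta> \<Longrightarrow> f (- x) = f x"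
    and f_diff: "\<And>x y b. \<bar>x\<bar> \<le> b \<Longrightarrow> \<bar>y\<bar> \<le> b \<Longrightarrow> b < \<delta> \<Longrightarrow>
        \<bar>f x - f y + a * (x\<^sup>2 - y\<^sup>2)\<bar> \<le> \<eta> * (a * b * \<bar>x - y\<bar>)"
begin

lemma a_sq_le: "\<bar>x\<bar> < \<delta> \<Longrightarrow> a * x\<^sup>2 \<le> \<eta>"
  using order_trans[OF mult_left_mono[of "x\<^sup>2" "\<delta>\<^sup>2" a] a_delta] a_pos power_mono[of "\<bar>x\<bar>" \<delta> 2]
  by simp

lemma f_bounds:
  assumes "\<bar>x\<bar> < \<delta>"
  shows "f x \<le> 0" "\<bar>f x\<bar> \<le> 2 * (a * x\<^sup>2)" "\<bar>f x\<bar> \<le> 2 * \<eta>"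
proof -
  have "\<bar>f x + a * x\<^sup>2\<bar> \<le> \<eta> * (a * x\<^sup>2)"
    using f_diff[of x "\<bar>x\<bar>" 0] assms f_zero by (simp add: power2_eq_square mult.assoc)
  also have "\<dots> \<le> 1 * (a * x\<^sup>2)" using eta a_pos by (intro mult_right_mono) auto
  finally show "f x \<le> 0" "\<bar>f x\<bar> \<le> 2 * (a * x\<^sup>2)" by auto
  then show "\<bar>f x\<bar> \<le> 2 * \<eta>" using a_sq_le[OF assms] by linarith
qed

lemma f_lipschitz:
  assumes "\<bar>x\<bar> \<le> b" "\<bar>y\<bar> \<le> b" "b < \<delta>"
  shows "\<bar>f x - f y\<bar> \<le> 3 * (a * b * \<bar>x - y\<bar>)"
proof -
  have b: "0 \<le> b" using assms by linarith
  have "\<bar>a * (x\<^sup>2 - y\<^sup>2)\<bar> = a * (\<bar>x + y\<bar> * \<bar>x - y\<bar>)"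
    using a_pos by (simp add: power2_eq_square square_diff_square_factored abs_mult)
  also have "\<dots> \<le> a * ((2 * b) * \<bar>x - y\<bar>)"
    using a_pos assms by (intro mult_left_mono mult_right_mono) auto
  finally have 1: "\<bar>a * (x\<^sup>2 - y\<^sup>2)\<bar> \<le> 2 * (a * b * \<bar>x - y\<bar>)" by (simp add: mult_ac)
  have "\<eta> * (a * b * \<bar>x - y\<bar>) \<le> 1 * (a * b * \<bar>x - y\<bar>)"
    using eta a_pos b by (intro mult_right_mono) auto
  with f_diff[OF assms] 1 show ?thesis by linarith
qed

lemma force_lipschitz:
  assumes "\<bar>x\<bar> \<le> b" "\<bar>y\<bar> \<le> b" "b < \<delta>"
  shows "\<bar>x * (1 + f x) - y * (1 + f y)\<bar> \<le> 2 * \<bar>x - y\<bar>"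
proof -
  have b: "0 \<le> b" using assms by linarith
  have "x * (1 + f x) - y * (1 + f y) = (x - y) * (1 + f x) + y * (f x - f y)"
    by (simp add: algebra_simps)
  then have "\<bar>x * (1 + f x) - y * (1 + f y)\<bar> \<le> \<bar>x - y\<bar> * \<bar>1 + f x\<bar> + \<bar>y\<bar> * \<bar>f x - f y\<bar>"
    by (metis abs_mult abs_triangle_ineq)
  also have "\<bar>x - y\<bar> * \<bar>1 + f x\<bar> \<le> \<bar>x - y\<bar> * 1"
    using f_bounds[of x] assms eta by (intro mult_left_mono) auto
  also have "\<bar>y\<bar> * \<bar>f x - f y\<bar> \<le> b * (3 * (a * b * \<bar>x - y\<bar>))"
    using f_lipschitz[OF assms] assms b by (intro mult_mono) auto
  also have "\<dots> = 3 * (a * b\<^sup>2) * \<bar>x - y\<bar>" by (simp add: power2_eq_square mult_ac)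
  also have "\<dots> \<le> 1 * \<bar>x - y\<bar>"
    using a_sq_le[of b] b assms eta by (intro mult_right_mono) auto
  finally show ?thesis by simp
qed

lemma force_pos: "0 < y \<Longrightarrow> y < \<delta> \<Longrightarrow> 0 < y * (1 + f y)"
  using f_bounds(3)[of y] eta by (intro mult_pos_pos) linarith+

lemma solution_confined:
  assumes b: "0 < b" "b < \<delta>"
  shows "\<exists>M. \<forall>\<alpha> x v t. 0 \<le> \<alpha> \<longrightarrow> x 0 = b \<longrightarrow> v 0 = 0 \<longrightarrow>
     (\<forall>t\<ge>0. (x has_real_derivative v t) (at t within {0..}) \<and>
            (v has_real_derivative - (2 * \<alpha> * v t) - x t * (1 + f (x t))) (at t within {0..})) \<longrightarrow>
     0 \<le> t \<longrightarrow> \<bar>x t\<bar> \<le> b \<and> \<bar>v t\<bar> \<le> M"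
proof (rule energy_confinement[where g = "\<lambda>y. y * (1 + f y)" and \<delta> = \<delta>, OF _ _ _ b])
  show "continuous_on UNIV (\<lambda>y. y * (1 + f y))" by (intro continuous_intros f_cont)
  show "- y * (1 + f (- y)) = - (y * (1 + f y))" if "\<bar>y\<bar> < \<delta>" for y
    using f_even[OF that] by simp
qed (rule force_pos)

text \<open>
  The force is Lipschitz on \<open>[-b, b]\<close> only. Composing it with the projection onto \<open>[-b, b]\<close> makes the
  equation globally Lipschitz, and by energy confinement the solution of the modified equation never notices the
  change.
\<close>

lemma solution_exists:
  assumes b: "0 < b" "b < \<delta>" and al: "0 \<le> \<alpha>" "\<alpha> \<le> 1"
  shows "\<exists>x. pendulum_solution f b \<alpha> x"
proof -
  define c where "c y = max (-b) (min b y)" for y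
  have c: "\<bar>c y\<bar> \<le> b" "\<bar>c y - c z\<bar> \<le> \<bar>y - z\<bar>" "\<bar>y\<bar> \<le> b \<Longrightarrow> c y = y" for y z
    using b by (auto simp: c_def max_def min_def)
  define g where "g y = c y * (1 + f (c y))" for y
  have g: "\<bar>g y - g z\<bar> \<le> 2 * \<bar>y - z\<bar>" for y z
    unfolding g_def using order_trans[OF force_lipschitz[OF c(1) c(1) b(2)]] c(2)[of y z] by simp
  define F where "F = (\<lambda>(y, w). (w, - (2 * \<alpha> * w) - g y))"
  have "norm (F p - F q) \<le> 5 * norm (p - q)" for p q :: "real \<times> real"
  proof -
    obtain y w z u where pq: "p = (y, w)" "q = (z, u)" by (metis surj_pair)
    have "norm (F p - F q) \<le> \<bar>w - u\<bar> + \<bar>- (2 * \<alpha> * w) - g y - (- (2 * \<alpha> * u) - g z)\<bar>"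
      using norm_Pair_le[of "w - u" "- (2 * \<alpha> * w) - g y - (- (2 * \<alpha> * u) - g z)"]
      by (simp add: F_def pq)
    also have "- (2 * \<alpha> * w) - g y - (- (2 * \<alpha> * u) - g z) = - (2 * \<alpha> * (w - u)) - (g y - g z)"
      by (simp add: algebra_simps)
    also have "\<bar>- (2 * \<alpha> * (w - u)) - (g y - g z)\<bar> \<le> 2 * \<bar>w - u\<bar> + 2 * \<bar>y - z\<bar>"
    proof -
      have "\<bar>2 * \<alpha> * (w - u)\<bar> \<le> 2 * \<bar>w - u\<bar>"
        using al by (simp add: abs_mult mult_right_le_one_le mult_left_le_one_le)
      with g[of y z] show ?thesis by linarith
    qed
    finally have "norm (F p - F q) \<le> 3 * \<bar>w - u\<bar> + 2 * \<bar>y - z\<bar>" by simp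
    moreover have "\<bar>w - u\<bar> \<le> norm (p - q)" "\<bar>y - z\<bar> \<le> norm (p - q)"
      using norm_fst_le[of "y - z" "w - u"] norm_snd_le[of "w - u" "y - z"] by (simp_all add: pq)
    moreover have "Z \<le> 5 * C" if "Z \<le> 3 * A + 2 * B" "A \<le> C" "B \<le> C" for A B C Z :: real
      using that by linarith
    ultimately show ?thesis by blast
  qed
  from lipschitz_ode_global_solution[of F 5, OF this, of "(b, 0)"]
  obtain z where z: "z 0 = (b, 0)" "\<And>t. 0 \<le> t \<Longrightarrow> (z has_vector_derivative F (z t)) (at t within {0..})"
    by auto
  define x where "x t = fst (z t)" for t
  define v where "v t = snd (z t)" for t
  have d: "(x has_real_derivative v t) (at t within {0..})"
    "(v has_real_derivative - (2 * \<alpha> * v t) - g (x t)) (at t within {0..})" if "0 \<le> t" for t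
    using bounded_linear.has_vector_derivative[OF bounded_linear_fst z(2)[OF that]]
      bounded_linear.has_vector_derivative[OF bounded_linear_snd z(2)[OF that]]
    unfolding has_real_derivative_iff_has_vector_derivative x_def[abs_def] v_def[abs_def] F_def
    by (simp_all add: case_prod_beta)
  have "\<exists>M. \<forall>\<alpha> x v t. 0 \<le> \<alpha> \<longrightarrow> x 0 = b \<longrightarrow> v 0 = 0 \<longrightarrow>
     (\<forall>t\<ge>0. (x has_real_derivative v t) (at t within {0..}) \<and>
            (v has_real_derivative - (2 * \<alpha> * v t) - g (x t)) (at t within {0..})) \<longrightarrow>
     0 \<le> t \<longrightarrow> \<bar>x t\<bar> \<le> b \<and> \<bar>v t\<bar> \<le> M"
  proof (rule energy_confinement[where \<delta> = \<delta>])
    show "continuous_on UNIV g"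
      by (rule lipschitz_on_continuous_on[of 2], rule lipschitz_onI) (use g in \<open>auto simp: dist_norm\<close>)
    show "g (- y) = - g y" for y
    proof -
      have "c (- y) = - c y" using b by (auto simp: c_def max_def min_def)
      moreover have "f (- c y) = f (c y)" using c(1)[of y] b by (intro f_even) auto
      ultimately show ?thesis by (simp add: g_def)
    qed
    show "0 < g y" if "0 < y" for y
      unfolding g_def using that b by (intro force_pos) (auto simp: c_def)
  qed (use b in auto)
  then obtain M where M: "\<And>\<alpha> x v t. 0 \<le> \<alpha> \<Longrightarrow> x 0 = b \<Longrightarrow> v 0 = 0 \<Longrightarrow>
     (\<forall>t\<ge>0. (x has_real_derivative v t) (at t within {0..}) \<and>
            (v has_real_derivative - (2 * \<alpha> * v t) - g (x t)) (at t within {0..})) \<Longrightarrow>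
     0 \<le> t \<Longrightarrow> \<bar>x t\<bar> \<le> b \<and> \<bar>v t\<bar> \<le> M" by blast
  have "\<bar>x t\<bar> \<le> b" if "0 \<le> t" for t
    using M[OF al(1) _ _ _ that, of x v] d z(1) by (auto simp: x_def v_def)
  then have "g (x t) = x t * (1 + f (x t))" if "0 \<le> t" for t
    using that by (simp add: g_def c)
  with d z(1) have "pendulum_solution f b \<alpha> x"
    unfolding pendulum_solution_def by (intro conjI exI[of _ v]) (auto simp: x_def v_def)
  then show ?thesis by blast
qed

lemma solution_has_motion:
  assumes b: "0 < b" "b < \<delta>" and al: "0 \<le> \<alpha>" "\<alpha> \<le> 1" and sol: "pendulum_solution f b \<alpha> x"
  shows "\<exists>v \<theta>. pendulum_motion f b \<alpha> x v \<theta>"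
proof -
  from sol obtain v where init: "x 0 = b" "v 0 = 0"
    and dx: "\<And>t. 0 \<le> t \<Longrightarrow> (x has_real_derivative v t) (at t within {0..})"
    and dv: "\<And>t. 0 \<le> t \<Longrightarrow> (v has_real_derivative - (2 * \<alpha> * v t) - x t * (1 + f (x t))) (at t within {0..})"
    unfolding pendulum_solution_def by blast
  obtain M where M: "\<And>t. 0 \<le> t \<Longrightarrow> \<bar>x t\<bar> \<le> b \<and> \<bar>v t\<bar> \<le> M"
    using solution_confined[OF b] al init dx dv by metis
  have "continuous_on {0..} (\<lambda>t. f (x t))"
    by (rule continuous_on_compose2[OF f_cont continuous_on_halfline[OF dx]]) auto
  moreover have "\<bar>f (x t)\<bar> \<le> 1" if "0 \<le> t" for t
  proof -
    have "\<bar>x t\<bar> < \<delta>" using M[OF that] b by linarith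
    from f_bounds(3)[OF this] eta show ?thesis by linarith
  qed
  ultimately have "\<exists>\<theta>. \<theta> 0 = 0 \<and> (\<forall>t\<ge>0. x t \<noteq> 0 \<or> v t \<noteq> 0) \<and>
    (\<forall>t\<ge>0. x t = sqrt ((x t)\<^sup>2 + (v t)\<^sup>2) * cos (\<theta> t) \<and> v t = - (sqrt ((x t)\<^sup>2 + (v t)\<^sup>2) * sin (\<theta> t)) \<and>
     (\<theta> has_real_derivative 1 - \<alpha> * sin (2 * \<theta> t) + f (x t) * (cos (\<theta> t))\<^sup>2) (at t within {0..}))"
    by (intro polar_angle_exists[OF dx dv]) (use al init b in auto)
  then obtain \<theta> where th: "\<theta> 0 = 0" "\<forall>t\<ge>0. x t \<noteq> 0 \<or> v t \<noteq> 0"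
    "\<forall>t\<ge>0. x t = sqrt ((x t)\<^sup>2 + (v t)\<^sup>2) * cos (\<theta> t) \<and> v t = - (sqrt ((x t)\<^sup>2 + (v t)\<^sup>2) * sin (\<theta> t)) \<and>
     (\<theta> has_real_derivative 1 - \<alpha> * sin (2 * \<theta> t) + f (x t) * (cos (\<theta> t))\<^sup>2) (at t within {0..})"
    by blast
  then have "pendulum_motion f b \<alpha> x v \<theta>"
    unfolding pendulum_motion_def using init dx dv M by blast
  then show ?thesis by blast
qed

lemma motion_solution: "pendulum_motion f b \<alpha> x v \<theta> \<Longrightarrow> pendulum_solution f b \<alpha> x"
  unfolding pendulum_motion_def pendulum_solution_def by blast

lemma motion_exists:
  assumes "0 < b" "b < \<delta>" "0 \<le> \<alpha>" "\<alpha> \<le> 1"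
  shows "\<exists>x v \<theta>. pendulum_motion f b \<alpha> x v \<theta>"
  using solution_exists[OF assms] solution_has_motion[OF assms] by blast

lemma motionD:
  assumes "pendulum_motion f b \<alpha> x v \<theta>"
  shows "x 0 = b" "v 0 = 0" "\<theta> 0 = 0"
    "\<And>t. 0 \<le> t \<Longrightarrow> (x has_real_derivative v t) (at t within {0..})"
    "\<And>t. 0 \<le> t \<Longrightarrow> (v has_real_derivative - (2 * \<alpha> * v t) - x t * (1 + f (x t))) (at t within {0..})"
    "\<And>t. 0 \<le> t \<Longrightarrow> (\<theta> has_real_derivative 1 - \<alpha> * sin (2 * \<theta> t) + f (x t) * (cos (\<theta> t))\<^sup>2) (at t within {0..})"
    "\<And>t. 0 \<le> t \<Longrightarrow> \<bar>x t\<bar> \<le> b"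
    "\<And>t. 0 \<le> t \<Longrightarrow> \<exists>r>0. x t = r * cos (\<theta> t) \<and> v t = - (r * sin (\<theta> t))"
proof -
  fix t :: real assume t: "0 \<le> t"
  then have "x t = sqrt ((x t)\<^sup>2 + (v t)\<^sup>2) * cos (\<theta> t) \<and> v t = - (sqrt ((x t)\<^sup>2 + (v t)\<^sup>2) * sin (\<theta> t))"
    and "x t \<noteq> 0 \<or> v t \<noteq> 0"
    using assms unfolding pendulum_motion_def by blast+
  moreover from this(2) have "0 < (x t)\<^sup>2 + (v t)\<^sup>2" by (simp add: sum_power2_gt_zero_iff)
  then have "0 < sqrt ((x t)\<^sup>2 + (v t)\<^sup>2)" by simp
  ultimately show "\<exists>r>0. x t = r * cos (\<theta> t) \<and> v t = - (r * sin (\<theta> t))" by blast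
qed (use assms in \<open>unfold pendulum_motion_def, blast+\<close>)

text \<open>
  The Gronwall estimate for the differences of position, velocity and angle. The damping terms contribute
  \<open>2 (\<alpha> - \<beta>) w\<close> with a velocity \<open>w\<close> that is bounded independently of \<open>\<beta>\<close>, so one constant serves for all
  coefficients. For \<open>\<alpha> = \<beta>\<close> the result is uniqueness.
\<close>

lemma motion_lipschitz_in_damping:
  assumes b: "0 < b" "b < \<delta>" and T: "0 \<le> T"
  shows "\<exists>C. \<forall>\<alpha> \<beta> x v \<theta> y w \<phi>. 0 \<le> \<alpha> \<longrightarrow> \<alpha> \<le> 1 \<longrightarrow> 0 \<le> \<beta> \<longrightarrow> \<beta> \<le> 1 \<longrightarrow>
    pendulum_motion f b \<alpha> x v \<theta> \<longrightarrow> pendulum_motion f b \<beta> y w \<phi> \<longrightarrow>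
    \<bar>x T - y T\<bar> \<le> C * \<bar>\<alpha> - \<beta>\<bar> \<and> \<bar>\<theta> T - \<phi> T\<bar> \<le> C * \<bar>\<alpha> - \<beta>\<bar>"
proof -
  obtain M0 where M0: "\<And>\<alpha> x v t. 0 \<le> \<alpha> \<Longrightarrow> x 0 = b \<Longrightarrow> v 0 = 0 \<Longrightarrow>
     (\<forall>t\<ge>0. (x has_real_derivative v t) (at t within {0..}) \<and>
            (v has_real_derivative - (2 * \<alpha> * v t) - x t * (1 + f (x t))) (at t within {0..})) \<Longrightarrow>
     0 \<le> t \<Longrightarrow> \<bar>x t\<bar> \<le> b \<and> \<bar>v t\<bar> \<le> M0"
    using solution_confined[OF b] by blast
  define M where "M = max M0 0"
  define c where "c = 3 + 2 * M + 3 * (a * b)"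
  have M: "0 \<le> M" by (simp add: M_def)
  have ab: "0 \<le> a * b" using a_pos b by simp
  have c: "2 \<le> c" "2 * M \<le> c" "3 * (a * b) \<le> c" "0 \<le> c" using M ab by (auto simp: c_def)
  have main: "\<bar>x T - y T\<bar> \<le> exp (9 * c * T) * \<bar>\<alpha> - \<beta>\<bar> \<and> \<bar>\<theta> T - \<phi> T\<bar> \<le> exp (9 * c * T) * \<bar>\<alpha> - \<beta>\<bar>"
    if al: "0 \<le> \<alpha>" "\<alpha> \<le> 1" and be: "0 \<le> \<beta>" "\<beta> \<le> 1"
      and m1: "pendulum_motion f b \<alpha> x v \<theta>" and m2: "pendulum_motion f b \<beta> y w \<phi>"
    for \<alpha> \<beta> x v \<theta> y w \<phi>
  proof -
    note A = motionD[OF m1] and B = motionD[OF m2]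
    define e where "e = \<bar>\<alpha> - \<beta>\<bar>"
    let ?S = "\<lambda>u. \<bar>x u - y u\<bar> + \<bar>v u - w u\<bar> + \<bar>\<theta> u - \<phi> u\<bar> + e"
    have comb: "k1 * p + k2 * q + k3 * r + k4 * s \<le> c * (p + q + r + s)"
      if "k1 \<le> c" "k2 \<le> c" "k3 \<le> c" "k4 \<le> c" "0 \<le> p" "0 \<le> q" "0 \<le> r" "0 \<le> s" for k1 k2 k3 k4 p q r s
      using that by (simp add: distrib_left add_mono mult_right_mono)
    have "(x T - y T)\<^sup>2 + (v T - w T)\<^sup>2 + (\<theta> T - \<phi> T)\<^sup>2 \<le> e\<^sup>2 * exp (9 * c * T)"
    proof (rule gronwall_square_sum[where p = "\<lambda>u. x u - y u" and q = "\<lambda>u. v u - w u" and r = "\<lambda>u. \<theta> u - \<phi> u"])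
      fix u :: real assume u: "0 \<le> u"
      show "((\<lambda>u. x u - y u) has_real_derivative v u - w u) (at u within {0..})"
        by (intro DERIV_diff A B u)
      show "((\<lambda>u. v u - w u) has_real_derivative (- (2 * \<alpha> * v u) - x u * (1 + f (x u))) -
          (- (2 * \<beta> * w u) - y u * (1 + f (y u)))) (at u within {0..})"
        by (intro DERIV_diff A B u)
      show "((\<lambda>u. \<theta> u - \<phi> u) has_real_derivative
         (1 - \<alpha> * sin (2 * \<theta> u) + f (x u) * (cos (\<theta> u))\<^sup>2) -
         (1 - \<beta> * sin (2 * \<phi> u) + f (y u) * (cos (\<phi> u))\<^sup>2)) (at u within {0..})"
        by (intro DERIV_diff A B u)
      show "\<bar>v u - w u\<bar> \<le> c * ?S u"
        using comb[of 0 1 0 0 "\<bar>x u - y u\<bar>" "\<bar>v u - w u\<bar>" "\<bar>\<theta> u - \<phi> u\<bar>" e] c by (simp add: e_def)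
      have wM: "\<bar>w u\<bar> \<le> M" using M0[of \<beta> y w u] B be u by (auto simp: M_def)
      have "\<bar>(- (2 * \<alpha> * v u) - x u * (1 + f (x u))) - (- (2 * \<beta> * w u) - y u * (1 + f (y u)))\<bar>
        = \<bar>2 * \<alpha> * (v u - w u) + 2 * (\<alpha> - \<beta>) * w u + (x u * (1 + f (x u)) - y u * (1 + f (y u)))\<bar>"
        by (subst abs_minus_cancel[symmetric]) (simp only: algebra_simps)
      also have "\<dots> \<le> 2 * \<bar>x u - y u\<bar> + 2 * \<bar>v u - w u\<bar> + 0 * \<bar>\<theta> u - \<phi> u\<bar> + 2 * M * e"
      proof -
        have "\<bar>2 * \<alpha> * (v u - w u)\<bar> \<le> 2 * \<bar>v u - w u\<bar>"
          using al by (simp add: abs_mult mult_left_le_one_le)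
        moreover have "\<bar>2 * (\<alpha> - \<beta>) * w u\<bar> \<le> 2 * M * e"
        proof -
          have "\<bar>2 * (\<alpha> - \<beta>) * w u\<bar> = 2 * e * \<bar>w u\<bar>" by (simp only: abs_mult e_def abs_numeral)
          also have "\<dots> \<le> 2 * e * M" using wM by (intro mult_left_mono) (auto simp: e_def)
          finally show ?thesis by (simp add: mult_ac)
        qed
        moreover note force_lipschitz[OF A(7)[OF u] B(7)[OF u] b(2)]
        ultimately show ?thesis by linarith
      qed
      also have "\<dots> \<le> c * ?S u" by (rule comb) (use c M in \<open>auto simp: e_def\<close>)
      finally show "\<bar>(- (2 * \<alpha> * v u) - x u * (1 + f (x u))) - (- (2 * \<beta> * w u) - y u * (1 + f (y u)))\<bar> \<le> c * ?S u" .
      have "\<bar>(1 - \<alpha> * sin (2 * \<theta> u) + f (x u) * (cos (\<theta> u))\<^sup>2) -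
         (1 - \<beta> * sin (2 * \<phi> u) + f (y u) * (cos (\<phi> u))\<^sup>2)\<bar>
        = \<bar>\<alpha> * (sin (2 * \<phi> u) - sin (2 * \<theta> u)) + (\<beta> - \<alpha>) * sin (2 * \<phi> u)
           + f (x u) * ((cos (\<theta> u))\<^sup>2 - (cos (\<phi> u))\<^sup>2) + (f (x u) - f (y u)) * (cos (\<phi> u))\<^sup>2\<bar>"
        by (rule arg_cong[of _ _ abs]) (simp only: algebra_simps)
      also have "\<dots> \<le> 3 * (a * b) * \<bar>x u - y u\<bar> + 0 * \<bar>v u - w u\<bar> + 3 * \<bar>\<theta> u - \<phi> u\<bar> + 1 * e"
      proof -
        have le1: "\<bar>p * q\<bar> \<le> r" if "\<bar>p\<bar> \<le> 1" "\<bar>q\<bar> \<le> r" for p q r :: real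
          using that mult_mono[of "\<bar>p\<bar>" 1 "\<bar>q\<bar>" r] by (simp add: abs_mult)
        have "\<bar>sin (2 * \<phi> u) - sin (2 * \<theta> u)\<bar> \<le> 2 * \<bar>\<theta> u - \<phi> u\<bar>"
        proof -
          have "\<bar>2 * \<phi> u - 2 * \<theta> u\<bar> = 2 * \<bar>\<theta> u - \<phi> u\<bar>" by (simp add: abs_if)
          then show ?thesis using abs_sin_diff_le[of "2 * \<phi> u" "2 * \<theta> u"] by simp
        qed
        then have "\<bar>\<alpha> * (sin (2 * \<phi> u) - sin (2 * \<theta> u))\<bar> \<le> 2 * \<bar>\<theta> u - \<phi> u\<bar>"
          by (rule le1[rotated]) (use al in simp)
        moreover have "\<bar>sin (2 * \<phi> u) * (\<beta> - \<alpha>)\<bar> \<le> e"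
          by (rule le1) (auto simp: e_def)
        moreover have "\<bar>f (x u)\<bar> \<le> 1" using f_bounds(3)[of "x u"] A(7)[OF u] b eta by linarith
        then have "\<bar>f (x u) * ((cos (\<theta> u))\<^sup>2 - (cos (\<phi> u))\<^sup>2)\<bar> \<le> \<bar>\<theta> u - \<phi> u\<bar>"
          by (rule le1[OF _ abs_cos_square_diff_le])
        moreover have "\<bar>(cos (\<phi> u))\<^sup>2 * (f (x u) - f (y u))\<bar> \<le> 3 * (a * b * \<bar>x u - y u\<bar>)"
          by (rule le1[OF _ f_lipschitz[OF A(7)[OF u] B(7)[OF u] b(2)]]) (simp add: abs_square_le_1)
        moreover have "\<bar>A + B + C + D\<bar> \<le> 3 * (a * b) * X + 0 * V + 3 * Y + 1 * e"
          if "\<bar>A\<bar> \<le> 2 * Y" "\<bar>B\<bar> \<le> e" "\<bar>C\<bar> \<le> Y" "\<bar>D\<bar> \<le> 3 * (a * b * X)" for A B C D X V Y :: real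
          using that by (simp add: mult.assoc)
        ultimately show ?thesis by (simp only: mult.commute[of "sin _"] mult.commute[of "_\<^sup>2"])
      qed
      also have "\<dots> \<le> c * ?S u" by (rule comb) (use c M ab in \<open>auto simp: e_def c_def\<close>)
      finally show "\<bar>(1 - \<alpha> * sin (2 * \<theta> u) + f (x u) * (cos (\<theta> u))\<^sup>2) -
         (1 - \<beta> * sin (2 * \<phi> u) + f (y u) * (cos (\<phi> u))\<^sup>2)\<bar> \<le> c * ?S u" .
    qed (use A B c T in auto)
    also have "\<dots> \<le> (exp (9 * c * T) * e)\<^sup>2"
    proof -
      have "1 \<le> exp (9 * c * T)" using c T by simp
      then have "exp (9 * c * T) * 1 \<le> (exp (9 * c * T))\<^sup>2"
        unfolding power2_eq_square by (intro mult_left_mono) auto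
      from mult_left_mono[OF this, of "e\<^sup>2"] show ?thesis
        by (simp add: power_mult_distrib mult.commute)
    qed
    finally have "(x T - y T)\<^sup>2 + (v T - w T)\<^sup>2 + (\<theta> T - \<phi> T)\<^sup>2 \<le> (exp (9 * c * T) * e)\<^sup>2" .
    then have "(x T - y T)\<^sup>2 \<le> (exp (9 * c * T) * e)\<^sup>2" "(\<theta> T - \<phi> T)\<^sup>2 \<le> (exp (9 * c * T) * e)\<^sup>2"
      using zero_le_power2[of "x T - y T"] zero_le_power2[of "v T - w T"] zero_le_power2[of "\<theta> T - \<phi> T"]
      by linarith+
    then have "\<bar>x T - y T\<bar> \<le> \<bar>exp (9 * c * T) * e\<bar>" "\<bar>\<theta> T - \<phi> T\<bar> \<le> \<bar>exp (9 * c * T) * e\<bar>"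
      by (simp_all only: abs_le_square_iff)
    then show ?thesis by (simp add: e_def abs_mult)
  qed
  show ?thesis by (rule exI[of _ "exp (9 * c * T)"]) (use main in blast)
qed

lemma solution_unique:
  assumes b: "0 < b" "b < \<delta>" and al: "0 \<le> \<alpha>" "\<alpha> \<le> 1"
    and "pendulum_solution f b \<alpha> x" "pendulum_solution f b \<alpha> y" and t: "0 \<le> t"
  shows "y t = x t"
proof -
  obtain v \<theta> where m1: "pendulum_motion f b \<alpha> x v \<theta>"
    using solution_has_motion[OF b al assms(5)] by (elim exE)
  obtain w \<phi> where m2: "pendulum_motion f b \<alpha> y w \<phi>"
    using solution_has_motion[OF b al assms(6)] by (elim exE)
  obtain C where C: "\<forall>\<alpha> \<beta> x v \<theta> y w \<phi>. 0 \<le> \<alpha> \<longrightarrow> \<alpha> \<le> 1 \<longrightarrow> 0 \<le> \<beta> \<longrightarrow> \<beta> \<le> 1 \<longrightarrow>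
    pendulum_motion f b \<alpha> x v \<theta> \<longrightarrow> pendulum_motion f b \<beta> y w \<phi> \<longrightarrow>
    \<bar>x t - y t\<bar> \<le> C * \<bar>\<alpha> - \<beta>\<bar> \<and> \<bar>\<theta> t - \<phi> t\<bar> \<le> C * \<bar>\<alpha> - \<beta>\<bar>"
    using motion_lipschitz_in_damping[OF b t] ..
  from C[rule_format, OF al al m1 m2] have "\<bar>x t - y t\<bar> \<le> C * \<bar>\<alpha> - \<alpha>\<bar>" ..
  then show ?thesis by simp
qed

end

section \<open>The oscillation time\<close>

context softening_spring begin

lemma angle_upcrossing:
  assumes b: "0 < b" "b < \<delta>" and m: "pendulum_motion f b \<alpha> x v \<theta>"
    and c: "sin c = 0" and s: "0 \<le> s" "c \<le> \<theta> s" "s < t"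
  shows "c < \<theta> t"
proof (rule upcrossing_stays_above[OF motionD(6)[OF m] _ s])
  fix u assume u: "0 \<le> u" "\<theta> u = c"
  have "(cos c)\<^sup>2 = 1" using c sin_cos_squared_add[of c] by simp
  moreover have "\<bar>f (x u)\<bar> \<le> 2 * \<eta>" using motionD(7)[OF m u(1)] b by (intro f_bounds) simp
  ultimately show "0 < 1 - \<alpha> * sin (2 * \<theta> u) + f (x u) * (cos (\<theta> u))\<^sup>2"
    using u c eta by (simp add: sin_double)
qed auto

text \<open>
  With \<open>w = v + \<alpha> x\<close>, the quantity \<open>Q = w\<^sup>2 + x\<^sup>2\<close> satisfies
  \<open>Q' = - 2 \<alpha> Q + 2 (\<alpha>\<^sup>2 - f x) x w\<close>. For small \<open>f\<close> this is at most \<open>(\<alpha>\<^sup>2 + 1/4 - 2 \<alpha>) Q \<le> - Q / 2\<close> on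
  \<open>1/2 \<le> \<alpha> \<le> 1\<close>; unlike \<open>w\<^sup>2 + (1 - \<alpha>\<^sup>2) x\<^sup>2\<close>, which for the
  linear oscillator decays exactly like \<open>exp (- 2 \<alpha> t)\<close>, \<open>Q\<close> does not degenerate as \<open>\<alpha> \<rightarrow> 1\<close>.
\<close>

lemma damped_amplitude_decays:
  assumes b: "0 < b" "b < \<delta>" and al: "1/2 \<le> \<alpha>" "\<alpha> \<le> 1" and m: "pendulum_motion f b \<alpha> x v \<theta>"
    and t: "0 \<le> t"
  shows "(x t)\<^sup>2 \<le> 2 * b\<^sup>2 * exp (- (t / 2))"
proof -
  define Q where "Q t = (v t + \<alpha> * x t)\<^sup>2 + (x t)\<^sup>2" for t
  define Q' where "Q' t = 2 * (v t + \<alpha> * x t) * (- (2 * \<alpha> * v t) - x t * (1 + f (x t)) + \<alpha> * v t) + 2 * x t * v t" for t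
  have dQ: "(Q has_real_derivative Q' u) (at u within {0..})" if "0 \<le> u" for u
    unfolding Q_def[abs_def] Q'_def
    by (rule derivative_eq_intros motionD[OF m] that refl)+ (simp add: algebra_simps)
  have Q'_le: "Q' u + Q u / 2 \<le> 0" if u: "0 \<le> u" for u
  proof -
    define w where "w = v u + \<alpha> * x u"
    have vw: "v u = w - \<alpha> * x u" by (simp add: w_def)
    have "\<bar>f (x u)\<bar> \<le> 2 * \<eta>" using motionD(7)[OF m u] b by (intro f_bounds) simp
    then have k: "\<bar>\<alpha>\<^sup>2 - f (x u)\<bar> \<le> \<alpha>\<^sup>2 + 1/4" using eta zero_le_power2[of \<alpha>] by linarith
    have "2 * (\<alpha>\<^sup>2 - f (x u)) * (x u * w) \<le> \<bar>\<alpha>\<^sup>2 - f (x u)\<bar> * (2 * \<bar>x u * w\<bar>)"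
    proof -
      have "2 * (\<alpha>\<^sup>2 - f (x u)) * (x u * w) = (\<alpha>\<^sup>2 - f (x u)) * (2 * (x u * w))" by simp
      also have "\<dots> \<le> \<bar>(\<alpha>\<^sup>2 - f (x u)) * (2 * (x u * w))\<bar>" by (rule abs_ge_self)
      finally show ?thesis by (simp only: abs_mult abs_numeral)
    qed
    also have "\<dots> \<le> (\<alpha>\<^sup>2 + 1/4) * (w\<^sup>2 + (x u)\<^sup>2)"
      using zero_le_power2[of "\<bar>w\<bar> - \<bar>x u\<bar>"] k
      by (intro mult_mono) (auto simp: power2_diff abs_mult algebra_simps)
    finally have 1: "2 * (\<alpha>\<^sup>2 - f (x u)) * (x u * w) \<le> (\<alpha>\<^sup>2 + 1/4) * (w\<^sup>2 + (x u)\<^sup>2)" .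
    have "Q' u + Q u / 2 = (1/2 - 2 * \<alpha>) * (w\<^sup>2 + (x u)\<^sup>2) + 2 * (\<alpha>\<^sup>2 - f (x u)) * (x u * w)"
      unfolding Q_def Q'_def vw by (simp add: power2_eq_square algebra_simps)
    also have "\<dots> \<le> (1/2 - 2 * \<alpha> + (\<alpha>\<^sup>2 + 1/4)) * (w\<^sup>2 + (x u)\<^sup>2)"
      using 1 by (simp only: distrib_right)
    also have "\<dots> \<le> 0"
    proof (rule mult_nonpos_nonneg)
      have "0 \<le> (\<alpha> - 1/2) * (3/2 - \<alpha>)" using al by simp
      moreover have "(\<alpha> - 1/2) * (3/2 - \<alpha>) = 2 * \<alpha> - \<alpha>\<^sup>2 - 3/4" by (simp add: power2_eq_square field_simps)
      ultimately show "1/2 - 2 * \<alpha> + (\<alpha>\<^sup>2 + 1/4) \<le> 0" by linarith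
    qed simp
    finally show ?thesis .
  qed
  have "Q t * exp (t / 2) - Q 0 * exp (0 / 2) \<le> 0 * (t - 0)"
  proof (rule halfline_deriv_le[where D = "\<lambda>t. Q t * exp (t / 2)"])
    show "((\<lambda>t. Q t * exp (t / 2)) has_real_derivative (Q' u + Q u / 2) * exp (u / 2)) (at u within {0..})"
      if "0 \<le> u" for u
      using that by (auto intro!: derivative_eq_intros dQ simp: algebra_simps)
    show "(Q' u + Q u / 2) * exp (u / 2) \<le> 0" if "0 < u" for u
      using Q'_le[of u] that by (intro mult_nonpos_nonneg) auto
  qed (use t in auto)
  then have "Q t * exp (t / 2) \<le> Q 0" by simp
  then have "Q t \<le> Q 0 * exp (- (t / 2))" by (simp add: exp_minus field_simps)
  also have "Q 0 \<le> 2 * b\<^sup>2"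
  proof -
    have "(\<alpha> * b)\<^sup>2 \<le> 1 * b\<^sup>2"
      unfolding power_mult_distrib using al by (intro mult_right_mono) (auto simp: power_le_one)
    then show ?thesis using motionD(1,2)[OF m] by (simp add: Q_def)
  qed
  finally have "Q t \<le> 2 * b\<^sup>2 * exp (- (t / 2))" by simp
  then show ?thesis unfolding Q_def using zero_le_power2[of "v t + \<alpha> * x t"] by linarith
qed

lemma angle_speed_lower_bound:
  fixes y :: real
  assumes "0 \<le> \<alpha>" "\<bar>q\<bar> \<le> k"
  shows "1 - \<alpha> - k \<le> 1 - \<alpha> * sin (2 * y) + q * (cos y)\<^sup>2"
proof -
  have "\<alpha> * sin (2 * y) \<le> \<alpha> * 1" using assms by (intro mult_left_mono) auto
  moreover have "\<bar>q * (cos y)\<^sup>2\<bar> \<le> k * 1"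
    unfolding abs_mult using assms by (intro mult_mono) (auto simp: abs_square_le_1)
  ultimately show ?thesis by linarith
qed

text \<open>
  For \<open>\<alpha> \<le> 1/2\<close> the smallness of \<open>f\<close> suffices from the start. For larger \<open>\<alpha>\<close> the margin \<open>1 - \<alpha>\<close> may be smaller
  than \<open>\<bar>f (x 0)\<bar>\<close>, and one waits until the decay of the amplitude has made \<open>\<bar>f x\<bar> \<le> (1 - \<alpha>) / 2\<close>.
\<close>

lemma angle_eventually_increasing:
  assumes b: "0 < b" "b < \<delta>" and al: "0 \<le> \<alpha>" "\<alpha> < 1" and m: "pendulum_motion f b \<alpha> x v \<theta>"
  shows "\<exists>k>0. \<exists>t0\<ge>0. \<forall>t\<ge>t0. k \<le> 1 - \<alpha> * sin (2 * \<theta> t) + f (x t) * (cos (\<theta> t))\<^sup>2"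
proof (cases "\<alpha> \<le> 1/2")
  case True
  have "1/4 \<le> 1 - \<alpha> * sin (2 * \<theta> t) + f (x t) * (cos (\<theta> t))\<^sup>2" if "0 \<le> t" for t
  proof -
    have "\<bar>f (x t)\<bar> \<le> 2 * \<eta>" using motionD(7)[OF m that] b by (intro f_bounds) simp
    from angle_speed_lower_bound[OF al(1) this, of "\<theta> t"] True eta show ?thesis by linarith
  qed
  then show ?thesis by (intro exI[of _ "1/4"] conjI exI[of _ 0]) auto
next
  case False
  define C where "C = 4 * a * b\<^sup>2"
  define k where "k = (1 - \<alpha>) / 2"
  have k: "0 < k" using al by (simp add: k_def)
  have C: "0 < C" using a_pos b by (simp add: C_def)
  have "k \<le> 1 - \<alpha> * sin (2 * \<theta> t) + f (x t) * (cos (\<theta> t))\<^sup>2" if t: "2 * C / k \<le> t" for t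
  proof -
    have t0: "0 \<le> t" using t C k by (meson divide_nonneg_pos less_imp_le mult_nonneg_nonneg order_trans zero_le_numeral)
    have "\<bar>f (x t)\<bar> \<le> 2 * (a * (x t)\<^sup>2)" using motionD(7)[OF m t0] b by (intro f_bounds) simp
    also have "\<dots> \<le> 2 * (a * (2 * b\<^sup>2 * exp (- (t / 2))))"
      using a_pos damped_amplitude_decays[OF b _ _ m t0] False al by (intro mult_left_mono) auto
    also have "\<dots> = C / exp (t / 2)" by (simp add: C_def exp_minus field_simps)
    also have "\<dots> \<le> k"
    proof -
      have "C \<le> k * (t / 2)" using t k by (simp add: field_simps)
      also have "\<dots> \<le> k * exp (t / 2)"
        using k exp_ge_add_one_self[of "t / 2"] by (intro mult_left_mono) linarith+
      finally show ?thesis by (simp add: field_simps)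
    qed
    finally have "\<bar>f (x t)\<bar> \<le> k" .
    from angle_speed_lower_bound[OF al(1) this, of "\<theta> t"] show ?thesis by (simp add: k_def field_simps)
  qed
  with k C show ?thesis by (intro exI[of _ k] conjI exI[of _ "2 * C / k"]) auto
qed

lemma angle_hits_full_turn:
  assumes b: "0 < b" "b < \<delta>" and al: "0 \<le> \<alpha>" "\<alpha> < 1" and m: "pendulum_motion f b \<alpha> x v \<theta>"
  shows "\<exists>T>0. \<theta> T = 2 * pi \<and> (\<forall>t. 0 \<le> t \<longrightarrow> t < T \<longrightarrow> \<theta> t < 2 * pi) \<and> (\<forall>t>T. 2 * pi < \<theta> t)"
proof -
  obtain k t0 where k: "0 < k" "0 \<le> t0"
    and inc: "\<And>t. t0 \<le> t \<Longrightarrow> k \<le> 1 - \<alpha> * sin (2 * \<theta> t) + f (x t) * (cos (\<theta> t))\<^sup>2"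
    using angle_eventually_increasing[OF assms] by blast
  have "0 \<le> \<theta> t0"
    using angle_upcrossing[OF b m, of 0 0 t0] motionD(3)[OF m] k by (cases "t0 = 0") auto
  define t1 where "t1 = t0 + 2 * pi / k"
  have "k * (t1 - t0) \<le> \<theta> t1 - \<theta> t0"
    by (rule halfline_deriv_ge[OF motionD(6)[OF m]]) (use inc k in \<open>auto simp: t1_def\<close>)
  then have "2 * pi \<le> \<theta> t1" using \<open>0 \<le> \<theta> t0\<close> k by (simp add: t1_def)
  moreover have "continuous_on {0..t1} \<theta>"
    by (rule continuous_on_subset[OF continuous_on_halfline[OF motionD(6)[OF m]]]) auto
  moreover have "0 \<le> t1" using k by (simp add: t1_def)
  ultimately obtain T where T: "0 \<le> T" "\<theta> T = 2 * pi"
    using IVT'[of \<theta> 0 "2 * pi" t1] motionD(3)[OF m] by auto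
  have "T \<noteq> 0" using T motionD(3)[OF m] by auto
  have up: "2 * pi < \<theta> t" if "0 \<le> s" "2 * pi \<le> \<theta> s" "s < t" for s t
    using angle_upcrossing[OF b m _ that] by simp
  have "\<theta> t < 2 * pi" if "0 \<le> t" "t < T" for t
    using up[of t T] that T by force
  then show ?thesis using T up[of T] \<open>T \<noteq> 0\<close> by (intro exI[of _ T]) auto
qed

lemma local_max_velocity_zero:
  assumes m: "pendulum_motion f b \<alpha> x v \<theta>" and t: "0 < t" and max: "local_max_at x t"
  shows "v t = 0"
proof -
  have d: "(x has_real_derivative v t) (at t)"
    using motionD(4)[OF m, of t] t by (simp add: at_within_atLeast_0)
  from max obtain e where e: "0 < e" "\<And>s. s \<noteq> t \<Longrightarrow> dist s t < e \<Longrightarrow> x s \<le> x t"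
    unfolding local_max_at_def eventually_at by auto
  show ?thesis
    by (rule DERIV_local_max[OF d e(1)]) (metis e(2) dist_real_def abs_minus_commute order_refl)
qed

lemma sin_zero_in_open_period: "0 < y \<Longrightarrow> y < 2 * pi \<Longrightarrow> sin y = 0 \<Longrightarrow> y = pi" for y :: real
proof (rule ccontr)
  assume y: "0 < y" "y < 2 * pi" "sin y = 0" "y \<noteq> pi"
  then show False
    using sin_gt_zero[of y] sin_gt_zero[of "y - pi"] by (cases "y < pi") (auto simp: sin_diff)
qed

text \<open>
  The velocity has the sign of \<open>- sin \<theta>\<close>, so \<open>x\<close> changes from increasing to decreasing when \<open>\<theta>\<close> passes
  \<open>2 \<pi>\<close>. Before that time the velocity vanishes only at \<open>\<theta> = \<pi>\<close>, after which \<open>x\<close> increases; this is no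
  local maximum.
\<close>

lemma motion_osc_time:
  assumes b: "0 < b" "b < \<delta>" and al: "0 \<le> \<alpha>" "\<alpha> < 1" and m: "pendulum_motion f b \<alpha> x v \<theta>"
  shows "\<exists>T>0. \<theta> T = 2 * pi \<and> (\<forall>t. 0 \<le> t \<longrightarrow> t < T \<longrightarrow> \<theta> t < 2 * pi) \<and> (\<forall>t>T. 2 * pi < \<theta> t) \<and>
    (\<forall>T'. is_osc_time f b \<alpha> T' \<longleftrightarrow> T' = T)"
proof -
  obtain T where T: "0 < T" "\<theta> T = 2 * pi" and below: "\<And>t. 0 \<le> t \<Longrightarrow> t < T \<Longrightarrow> \<theta> t < 2 * pi"
    and above: "\<And>t. T < t \<Longrightarrow> 2 * pi < \<theta> t"
    using angle_hits_full_turn[OF assms] by blast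
  have cont: "isCont \<theta> t" and contx: "isCont x t" if "0 < t" for t
    using DERIV_isCont motionD(4,6)[OF m, of t] that by (auto simp: at_within_atLeast_0)
  have cx: "continuous_on {s..u} x" if "0 \<le> s" for s u
    by (rule continuous_on_subset[OF continuous_on_halfline[OF motionD(4)[OF m]]]) (use that in auto)
  have dx: "(x has_real_derivative v t) (at t)" if "0 < t" for t
    using motionD(4)[OF m, of t] that by (simp add: at_within_atLeast_0)
  have vsign: "0 < v t" if "0 \<le> t" "sin (\<theta> t) < 0" for t
  proof -
    obtain r where "0 < r" "v t = - (r * sin (\<theta> t))" using motionD(8)[OF m \<open>0 \<le> t\<close>] by blast
    then show ?thesis using \<open>sin (\<theta> t) < 0\<close> by (simp add: mult_pos_neg)
  qed
  have vsign': "v t < 0" if "0 \<le> t" "0 < sin (\<theta> t)" for t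
  proof -
    obtain r where "0 < r" "v t = - (r * sin (\<theta> t))" using motionD(8)[OF m \<open>0 \<le> t\<close>] by blast
    then show ?thesis using \<open>0 < sin (\<theta> t)\<close> by simp
  qed
  have sin3: "sin y < 0" if "pi < y" "y < 2 * pi" for y using sin_lt_zero[of y] that by simp
  have sin1: "0 < sin y" if "2 * pi < y" "y < 3 * pi" for y
    using sin_gt_zero[of "y - 2 * pi"] that by (simp add: sin_diff)
  have maxT: "local_max_at x T"
  proof -
    have "(\<theta> \<longlongrightarrow> 2 * pi) (at T)" using cont[OF T(1)] T by (simp add: isCont_def)
    then have "\<forall>\<^sub>F s in at T. \<theta> s \<in> {pi<..<3*pi}" by (intro topological_tendstoD) auto
    then obtain e where e: "0 < e" "\<And>s. s \<noteq> T \<Longrightarrow> dist s T < e \<Longrightarrow> pi < \<theta> s \<and> \<theta> s < 3 * pi"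
      unfolding eventually_at by auto
    define d where "d = min e T"
    have d: "0 < d" "d \<le> e" "d \<le> T" using e T by (auto simp: d_def)
    have "x s \<le> x T" if s: "s \<noteq> T" "dist s T < d" for s
    proof (cases "s < T")
      case True
      have s0: "0 < s" using s d by (auto simp: dist_real_def)
      have "x s < x T"
      proof (rule DERIV_pos_imp_increasing_open[OF True])
        fix u assume u: "s < u" "u < T"
        have "sin (\<theta> u) < 0"
          using e(2)[of u] below[of u] u s s0 d by (intro sin3) (auto simp: dist_real_def)
        then show "\<exists>l. (x has_real_derivative l) (at u) \<and> 0 < l"
          using dx[of u] vsign[of u] u s0 by auto
      qed (use cx s0 in auto)
      then show ?thesis by simp
    next
      case False
      then have sT: "T < s" using s by simp
      have "x s < x T"
      proof (rule DERIV_neg_imp_decreasing_open[OF sT])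
        fix u assume u: "T < u" "u < s"
        have "0 < sin (\<theta> u)"
          using e(2)[of u] above[of u] u s d by (intro sin1) (auto simp: dist_real_def)
        then show "\<exists>l. (x has_real_derivative l) (at u) \<and> l < 0"
          using dx[of u] vsign'[of u] u T by auto
      qed (use cx T in auto)
      then show ?thesis by simp
    qed
    then show ?thesis unfolding local_max_at_def eventually_at using d by auto
  qed
  have nomax: "\<not> local_max_at x t" if t: "0 < t" "t < T" for t
  proof
    assume max: "local_max_at x t"
    have v0: "v t = 0" by (rule local_max_velocity_zero[OF m t(1) max])
    obtain r where "0 < r" "v t = - (r * sin (\<theta> t))" using motionD(8)[OF m, of t] t by auto
    then have "sin (\<theta> t) = 0" using v0 by simp
    moreover have "0 < \<theta> t"
      using angle_upcrossing[OF b m, of 0 0 t] motionD(3)[OF m] t by simp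
    ultimately have th: "\<theta> t = pi" using sin_zero_in_open_period below[of t] t by simp
    from max obtain e where e: "0 < e" "\<And>s. s \<noteq> t \<Longrightarrow> dist s t < e \<Longrightarrow> x s \<le> x t"
      unfolding local_max_at_def eventually_at by auto
    define s where "s = t + min (e / 2) ((T - t) / 2)"
    have s: "t < s" "s < T" "dist s t < e"
      using e(1) t by (auto simp: s_def min_def dist_real_def field_simps)
    have "x t < x s"
    proof (rule DERIV_pos_imp_increasing_open[OF s(1)])
      fix u assume u: "t < u" "u < s"
      have "pi < \<theta> u" using angle_upcrossing[OF b m, of pi t u] th t u by simp
      then have "sin (\<theta> u) < 0" using below[of u] u s t by (intro sin3) auto
      then show "\<exists>l. (x has_real_derivative l) (at u) \<and> 0 < l"
        using dx[of u] vsign[of u] u t by auto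
    qed (use cx t in auto)
    with e(2)[of s] s show False by auto
  qed
  have isT: "is_osc_time f b \<alpha> T"
    unfolding is_osc_time_def using motion_solution[OF m] T maxT nomax by blast
  have uniq: "T' = T" if osc: "is_osc_time f b \<alpha> T'" for T'
  proof -
    obtain y where y: "pendulum_solution f b \<alpha> y" "0 < T'" "local_max_at y T'"
      "\<And>t. 0 < t \<Longrightarrow> t < T' \<Longrightarrow> \<not> local_max_at y t"
      using osc unfolding is_osc_time_def by blast
    have yx: "y t = x t" if "0 \<le> t" for t
      using solution_unique[OF b al(1) _ motion_solution[OF m] y(1) that] al by simp
    have same: "local_max_at y t \<longleftrightarrow> local_max_at x t" if t: "0 < t" for t
    proof -
      have "\<forall>\<^sub>F s in at t. 0 < s" using t by (intro order_tendstoD[of _ t] tendsto_ident_at)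
      then have "\<forall>\<^sub>F s in at t. (y s \<le> y t) = (x s \<le> x t)"
        by eventually_elim (use yx t in simp)
      then show ?thesis unfolding local_max_at_def by (rule eventually_subst)
    qed
    show ?thesis
      using nomax[of T'] y T maxT same[of T'] same[of T] by (cases T' T rule: linorder_cases) auto
  qed
  show ?thesis using T below above isT uniq by (intro exI[of _ T]) blast
qed

text \<open>
  Let \<open>s = sqrt (1 - \<alpha>)\<close> and \<open>p = \<theta> - \<pi>/4\<close>. From \<open>f \<le> 0\<close> and
  \<open>1 - sin (2 \<theta>) = 2 (sin p)\<^sup>2\<close> one gets \<open>\<theta>' \<le> s\<^sup>2 + 2 p\<^sup>2\<close>, so \<open>arctan (p / s)\<close> has
  derivative at most \<open>2 s\<close>. Over an oscillation it grows by at least a fixed positive amount, as \<open>p\<close> goes from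
  \<open>- \<pi>/4\<close> to \<open>7 \<pi>/4\<close>.
\<close>

lemma osc_time_lower_bound:
  assumes b: "0 < b" "b < \<delta>" and al: "0 \<le> \<alpha>" "\<alpha> < 1" and m: "pendulum_motion f b \<alpha> x v \<theta>"
    and T: "0 \<le> T" "\<theta> T = 2 * pi"
  shows "arctan (1 / 2) \<le> 2 * sqrt (1 - \<alpha>) * T"
proof -
  define s where "s = sqrt (1 - \<alpha>)"
  have s: "0 < s" "s \<le> 1" "s * s = 1 - \<alpha>" using al by (auto simp: s_def)
  define A where "A t = arctan ((\<theta> t - pi / 4) / s)" for t
  define \<theta>' where "\<theta>' t = 1 - \<alpha> * sin (2 * \<theta> t) + f (x t) * (cos (\<theta> t))\<^sup>2" for t
  have dA: "(A has_real_derivative inverse (1 + ((\<theta> u - pi / 4) / s)\<^sup>2) * (\<theta>' u / s)) (at u within {0..})"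
    if "0 \<le> u" for u
  proof -
    have "((\<lambda>t. (\<theta> t - pi / 4) / s) has_real_derivative \<theta>' u / s) (at u within {0..})"
      using DERIV_cdivide[OF DERIV_diff[OF motionD(6)[OF m that] DERIV_const[of "pi/4"]], of s]
      by (simp add: \<theta>'_def)
    from DERIV_chain'[OF this DERIV_arctan] show ?thesis by (simp add: A_def[abs_def])
  qed
  have bd: "inverse (1 + ((\<theta> u - pi / 4) / s)\<^sup>2) * (\<theta>' u / s) \<le> 2 * s" if u: "0 \<le> u" for u
  proof -
    define p where "p = \<theta> u - pi / 4"
    have "f (x u) * (cos (\<theta> u))\<^sup>2 \<le> 0"
      using motionD(7)[OF m u] b by (intro mult_nonpos_nonneg f_bounds) auto
    then have "\<theta>' u \<le> (1 - \<alpha>) + \<alpha> * (1 - sin (2 * \<theta> u))" by (simp add: \<theta>'_def algebra_simps)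
    also have "\<dots> \<le> (1 - \<alpha>) + 1 * (1 - sin (2 * \<theta> u))"
      using al by (intro add_left_mono mult_right_mono) auto
    also have "sin (2 * \<theta> u) = cos (2 * p)"
    proof -
      have "2 * \<theta> u = pi / 2 + 2 * p" by (simp add: p_def field_simps)
      then show ?thesis by (simp add: sin_add)
    qed
    also have "1 - cos (2 * p) = 2 * (sin p)\<^sup>2" by (simp add: cos_double_sin)
    also have "(sin p)\<^sup>2 \<le> p\<^sup>2" using abs_sin_x_le_abs_x[of p] by (simp add: abs_le_square_iff)
    finally have th': "\<theta>' u \<le> s * s + 2 * p\<^sup>2" using s by simp
    have pos: "0 < s * s + p\<^sup>2" using mult_pos_pos[OF s(1) s(1)] by (rule add_pos_nonneg) simp
    have "1 + (p / s)\<^sup>2 = (s * s + p\<^sup>2) / (s * s)"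
      using s(1) by (simp add: add_divide_distrib power2_eq_square)
    then have "inverse (1 + (p / s)\<^sup>2) * (\<theta>' u / s) = s * \<theta>' u / (s * s + p\<^sup>2)"
      using s(1) by simp
    also have "\<dots> \<le> s * (s * s + 2 * p\<^sup>2) / (s * s + p\<^sup>2)"
      by (intro divide_right_mono mult_left_mono th' less_imp_le pos s(1))
    also have "\<dots> \<le> s * (2 * (s * s + p\<^sup>2)) / (s * s + p\<^sup>2)"
      by (intro divide_right_mono mult_left_mono less_imp_le[OF pos] less_imp_le[OF s(1)]) simp
    also have "\<dots> = 2 * s"
    proof -
      have "s * (2 * D) / D = 2 * s" if "0 < D" for D :: real using that by simp
      from this[OF pos] show ?thesis .
    qed
    finally show ?thesis by (simp add: p_def)
  qed
  have "A T - A 0 \<le> 2 * s * (T - 0)"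
    by (rule halfline_deriv_le[OF dA]) (use bd T in auto)
  moreover have "0 \<le> A T" using T s by (simp add: A_def)
  moreover have "A 0 = - arctan (pi / 4 / s)" using motionD(3)[OF m] by (simp add: A_def arctan_minus)
  moreover have "arctan (1 / 2) \<le> arctan (pi / 4 / s)"
  proof (rule arctan_monotone')
    have "1/2 * s \<le> 1/2 * 1" using s by (intro mult_left_mono) auto
    then have "1/2 * s \<le> pi / 4" using pi_ge_two by linarith
    then show "1/2 \<le> pi / 4 / s" using s by (simp add: pos_le_divide_eq)
  qed
  ultimately show ?thesis by (simp add: s_def)
qed

end

section \<open>Weak damping advances the phase\<close>

lemma forced_oscillator_deviation:
  fixes u p h :: "real \<Rightarrow> real"
  assumes du: "\<And>s. 0 \<le> s \<Longrightarrow> (u has_real_derivative p s) (at s within {0..})"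
    and dp: "\<And>s. 0 \<le> s \<Longrightarrow> (p has_real_derivative - u s + h s) (at s within {0..})"
    and h: "\<And>s. 0 < s \<Longrightarrow> s < t \<Longrightarrow> \<bar>h s\<bar> \<le> H" and t: "0 \<le> t"
  shows "\<bar>u t - (u 0 * cos t + p 0 * sin t)\<bar> \<le> 2 * (H * t)"
proof -
  define A where "A s = u s * cos s - p s * sin s" for s
  define B where "B s = u s * sin s + p s * cos s" for s
  have dA: "(A has_real_derivative - (h s * sin s)) (at s within {0..})" if "0 \<le> s" for s
    unfolding A_def[abs_def]
    by (rule derivative_eq_intros du dp that refl)+ (simp add: algebra_simps)
  have dB: "(B has_real_derivative h s * cos s) (at s within {0..})" if "0 \<le> s" for s
    unfolding B_def[abs_def]
    by (rule derivative_eq_intros du dp that refl)+ (simp add: algebra_simps)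
  have A: "\<bar>A t - A 0\<bar> \<le> H * (t - 0)"
    by (rule halfline_deriv_abs[OF dA]) (use t abs_mult_bound[OF h abs_sin_le_one] in auto)
  have B: "\<bar>B t - B 0\<bar> \<le> H * (t - 0)"
    by (rule halfline_deriv_abs[OF dB]) (use t abs_mult_bound[OF h abs_cos_le_one] in auto)
  have alg: "U * (c * c + s * s) = (U * c - P * s) * c + (U * s + P * c) * s" for U P c s :: real
    by (simp add: algebra_simps)
  have "cos t * cos t + sin t * sin t = 1"
    using sin_cos_squared_add2[of t] by (simp add: power2_eq_square)
  then have "u t = A t * cos t + B t * sin t"
    using alg[of "u t" "cos t" "sin t" "p t"] by (simp add: A_def B_def)
  then have "u t - (u 0 * cos t + p 0 * sin t) = (A t - A 0) * cos t + (B t - B 0) * sin t"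
    by (simp add: A_def B_def algebra_simps)
  moreover have "\<bar>(A t - A 0) * cos t\<bar> \<le> H * t * 1" "\<bar>(B t - B 0) * sin t\<bar> \<le> H * t * 1"
    using A B by (intro abs_mult_bound; simp)+
  ultimately show ?thesis by linarith
qed

text \<open>
  Obtained from \<open>(cos t) ^ 4 = 3/8 + cos (2 t) / 2 + cos (4 t) / 8\<close> by parts.
\<close>

lemma quartic_cosine_primitive:
  "((\<lambda>t. 3 * t\<^sup>2 / 16 + t * sin (2 * t) / 4 + cos (2 * t) / 8 + t * sin (4 * t) / 32 + cos (4 * t) / 128)
     has_real_derivative t * (cos t) ^ 4) (at t within S)"
proof -
  have c2: "cos (2 * t) = 2 * (cos t)\<^sup>2 - 1" by (rule cos_double_cos)
  have "cos (4 * t) = 2 * (cos (2 * t))\<^sup>2 - 1" using cos_double_cos[of "2 * t"] by simp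
  then have c4: "cos (4 * t) = 8 * (cos t) ^ 4 - 8 * (cos t)\<^sup>2 + 1"
    unfolding c2 by (simp add: power2_eq_square power4_eq_xxxx algebra_simps)
  have "((\<lambda>t. 3 * t\<^sup>2 / 16 + t * sin (2 * t) / 4 + cos (2 * t) / 8 + t * sin (4 * t) / 32 + cos (4 * t) / 128)
     has_real_derivative t * (3 / 8 + cos (2 * t) / 2 + cos (4 * t) / 8)) (at t within S)"
    by (auto intro!: derivative_eq_intros simp: field_simps)
  also have "3 / 8 + cos (2 * t) / 2 + cos (4 * t) / 8 = (cos t) ^ 4"
    unfolding c2 c4 by (simp add: field_simps)
  finally show ?thesis .
qed

text \<open>
  Here \<open>X\<close> is the damped and \<open>Y\<close> the undamped motion, both scaled to amplitude \<open>1\<close>, and \<open>T\<close> is the period of \<open>Y\<close>,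
  close to \<open>2 \<pi>\<close>. The proof is the Wronskian computation outlined at the beginning. The errors in \<open>W'\<close> end up as
  explicit multiples of \<open>\<eta> k\<close> with \<open>k = \<mu> \<alpha>\<close>. The choice \<open>\<alpha> = \<eta> \<mu>\<close> makes \<open>\<alpha>\<^sup>2 = \<eta> k\<close>, the
  direct effect of the damping on the frequency, such an error too, while the gain is of order \<open>k\<close>.
\<close>

lemma damping_advances_phase:
  fixes X V Y U F :: "real \<Rightarrow> real"
  assumes dX: "\<And>t. 0 \<le> t \<Longrightarrow> (X has_real_derivative V t) (at t within {0..})"
    and dV: "\<And>t. 0 \<le> t \<Longrightarrow> (V has_real_derivative - (2 * \<alpha> * V t) - X t * (1 + F (X t))) (at t within {0..})"
    and dY: "\<And>t. 0 \<le> t \<Longrightarrow> (Y has_real_derivative U t) (at t within {0..})"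
    and dU: "\<And>t. 0 \<le> t \<Longrightarrow> (U has_real_derivative - (Y t * (1 + F (Y t)))) (at t within {0..})"
    and init: "X 0 = 1" "V 0 = 0" "Y 0 = 1" "U 0 = 0"
    and bX: "\<And>t. 0 \<le> t \<Longrightarrow> \<bar>X t\<bar> \<le> 1" and bY: "\<And>t. 0 \<le> t \<Longrightarrow> \<bar>Y t\<bar> \<le> 1"
    and F0: "F 0 = 0"
    and F: "\<And>x y. \<bar>x\<bar> \<le> 1 \<Longrightarrow> \<bar>y\<bar> \<le> 1 \<Longrightarrow> \<bar>F x - F y + \<mu> * (x\<^sup>2 - y\<^sup>2)\<bar> \<le> \<eta> * (\<mu> * \<bar>x - y\<bar>)"
    and mu: "0 < \<mu>" "\<mu> \<le> \<eta>" and eta: "\<eta> \<le> 1 / 1000000" and alpha: "\<alpha> = \<eta> * \<mu>"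
    and T: "6 \<le> T" "T \<le> 7" "Y T = 1" "U T = 0"
  shows "V T < 0"
proof -
  have eta0: "0 < \<eta>" using mu by simp
  define k where "k = \<mu> * \<alpha>"
  have al: "0 < \<alpha>" "\<alpha> \<le> \<mu> / 1000000" "\<alpha> \<le> 1 / 1000000"
  proof -
    show "0 < \<alpha>" using eta0 mu alpha by simp
    show "\<alpha> \<le> \<mu> / 1000000" unfolding alpha using mult_right_mono[OF eta, of \<mu>] mu by simp
    then show "\<alpha> \<le> 1 / 1000000" using mu eta by linarith
  qed
  have mu1: "\<mu> \<le> 1 / 1000000" using mu eta by linarith
  have k0: "0 < k" using mu al by (simp add: k_def)
  have aa: "\<alpha> * \<alpha> = \<eta> * k" by (simp add: k_def alpha)
  have etak: "\<eta> * k \<le> k / 1000000" using mult_right_mono[OF eta, of k] k0 by simp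
  have muk: "\<mu> * k \<le> \<eta> * k" using mu k0 by (intro mult_right_mono) auto
  have aak: "\<alpha> * \<alpha> \<le> k" using aa etak k0 by linarith

  have Fb: "\<bar>F x\<bar> \<le> 2 * \<mu>" if "\<bar>x\<bar> \<le> 1" for x
  proof -
    have "\<bar>F x + \<mu> * x\<^sup>2\<bar> \<le> \<eta> * (\<mu> * \<bar>x\<bar>)" using F[of x 0] that F0 by simp
    also have "\<dots> \<le> 1 * (\<mu> * 1)" using that mu eta by (intro mult_mono mult_nonneg_nonneg) auto
    finally have "\<bar>F x + \<mu> * x\<^sup>2\<bar> \<le> \<mu>" by simp
    moreover have "0 \<le> \<mu> * x\<^sup>2" "\<mu> * x\<^sup>2 \<le> \<mu> * 1"
      using that mu by (auto intro!: mult_left_mono simp: abs_square_le_1)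
    ultimately show ?thesis by linarith
  qed
  have Fl: "\<bar>F x - F y\<bar> \<le> 3 * (\<mu> * \<bar>x - y\<bar>)" if "\<bar>x\<bar> \<le> 1" "\<bar>y\<bar> \<le> 1" for x y
  proof -
    have "\<bar>F x - F y + \<mu> * (x\<^sup>2 - y\<^sup>2)\<bar> \<le> 1 * (\<mu> * \<bar>x - y\<bar>)"
      by (rule order_trans[OF F[OF that]]) (use mu eta in \<open>intro mult_right_mono, auto\<close>)
    moreover have "\<bar>\<mu> * (x\<^sup>2 - y\<^sup>2)\<bar> \<le> 2 * (\<mu> * \<bar>x - y\<bar>)"
    proof -
      have "\<mu> * (x\<^sup>2 - y\<^sup>2) = \<mu> * (x - y) * (x + y)" by (simp add: power2_eq_square algebra_simps)
      also have "\<bar>\<dots>\<bar> \<le> \<mu> * \<bar>x - y\<bar> * 2"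
        using that mu by (intro abs_mult_bound) (auto simp: abs_mult)
      finally show ?thesis by (simp add: mult_ac)
    qed
    ultimately show ?thesis by linarith
  qed

  define E where "E t = exp (\<alpha> * t)" for t
  define y where "y t = E t * X t" for t
  define w where "w t = E t * (V t + \<alpha> * X t)" for t
  define u where "u t = y t - Y t" for t
  define p where "p t = w t - U t" for t
  define h where "h t = \<alpha> * \<alpha> * y t - F (X t) * u t - (F (X t) - F (Y t)) * Y t" for t
  have dE: "(E has_real_derivative E t * \<alpha>) (at t within {0..})" for t
    unfolding E_def[abs_def] by (auto intro!: derivative_eq_intros)
  have dy: "(y has_real_derivative w t) (at t within {0..})" if "0 \<le> t" for t
    unfolding y_def[abs_def] w_def
    by (rule derivative_eq_intros dE dX that refl)+ (simp add: algebra_simps)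
  have dw: "(w has_real_derivative - ((1 + F (X t) - \<alpha> * \<alpha>) * y t)) (at t within {0..})" if "0 \<le> t" for t
    unfolding w_def[abs_def] y_def
    by (rule derivative_eq_intros dE dX dV that refl)+ (simp add: algebra_simps)
  have du: "(u has_real_derivative p t) (at t within {0..})" if "0 \<le> t" for t
    unfolding u_def[abs_def] p_def by (intro DERIV_diff dy dY that)
  have dp: "(p has_real_derivative - u t + h t) (at t within {0..})" if "0 \<le> t" for t
    unfolding p_def[abs_def] u_def h_def
    by (rule derivative_eq_intros dw dU that refl)+ (simp add: algebra_simps)
  have init': "u 0 = 0" "p 0 = \<alpha>" "w 0 = \<alpha>" "y 0 = 1"
    using init by (simp_all add: u_def p_def y_def w_def E_def)

  have Eb: "1 \<le> E t" "E t - 1 - \<alpha> * t \<le> 49 * (\<alpha> * \<alpha>)" "0 \<le> E t - 1 - \<alpha> * t" "E t - 1 \<le> 14 * \<alpha>" "E t \<le> 2"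
    if t: "0 \<le> t" "t \<le> 7" for t
  proof -
    have at: "0 \<le> \<alpha> * t" "\<alpha> * t \<le> \<alpha> * 7" using t al by auto
    show "1 \<le> E t" using at by (simp add: E_def)
    have "E t \<le> 1 + \<alpha> * t + (\<alpha> * t)\<^sup>2" unfolding E_def using at al by (intro exp_bound) linarith+
    moreover have "(\<alpha> * t)\<^sup>2 \<le> (\<alpha> * 7)\<^sup>2" using at by (intro power_mono)
    moreover have "(\<alpha> * 7)\<^sup>2 = 49 * (\<alpha> * \<alpha>)" by (simp add: power2_eq_square)
    ultimately show 1: "E t - 1 - \<alpha> * t \<le> 49 * (\<alpha> * \<alpha>)" by linarith
    show "0 \<le> E t - 1 - \<alpha> * t" using exp_ge_add_one_self[of "\<alpha> * t"] unfolding E_def by linarith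
    have "\<alpha> * \<alpha> \<le> 1 / 1000000 * \<alpha>" using al by (intro mult_right_mono) auto
    with 1 at show "E t - 1 \<le> 14 * \<alpha>" using al by linarith
    then show "E t \<le> 2" using al by linarith
  qed
  have yb: "\<bar>y t\<bar> \<le> 2" if "0 \<le> t" "t \<le> 7" for t
    using abs_mult_bound[of "E t" 2 "X t" 1] Eb(1,5)[OF that] bX[OF that(1)] by (simp add: y_def)
  have yX: "\<bar>X t * (E t - 1)\<bar> \<le> 14 * \<alpha>" if "0 \<le> t" "t \<le> 7" for t
    using abs_mult_bound[of "X t" 1 "E t - 1" "14 * \<alpha>"] Eb(1,4)[OF that] bX[OF that(1)] by simp
  have XY: "X t - Y t = u t - X t * (E t - 1)" for t by (simp add: u_def y_def algebra_simps)

  have Yc: "\<bar>Y t - cos t\<bar> \<le> 28 * \<mu>" if t: "0 \<le> t" "t \<le> 7" for t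
  proof -
    have "\<bar>Y t - (Y 0 * cos t + U 0 * sin t)\<bar> \<le> 2 * (2 * \<mu> * t)"
    proof (rule forced_oscillator_deviation[OF dY])
      show "(U has_real_derivative - Y s + (- (Y s * F (Y s)))) (at s within {0..})" if "0 \<le> s" for s
        using dU[OF that] by (simp add: algebra_simps)
      show "\<bar>- (Y s * F (Y s))\<bar> \<le> 2 * \<mu>" if "0 < s" for s
        using abs_mult_bound[OF bY Fb[OF bY], of s s] that by simp
    qed (use t in auto)
    moreover have "\<mu> * t \<le> \<mu> * 7" using t mu by simp
    ultimately show ?thesis using init by simp
  qed

  \<comment> \<open>\<open>u = y - Y\<close> is bounded by its own maximum \<open>m\<close> through the forcing term \<open>h\<close>; as \<open>m\<close> enters with a small factor, the bound closes.\<close>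
  obtain s where s: "0 \<le> s" "s \<le> 7" and sup: "\<And>t. 0 \<le> t \<Longrightarrow> t \<le> 7 \<Longrightarrow> \<bar>u t\<bar> \<le> \<bar>u s\<bar>"
  proof -
    have "continuous_on {0..7} (\<lambda>t. \<bar>u t\<bar>)"
      by (intro continuous_intros continuous_on_subset[OF continuous_on_halfline[OF du]]) auto
    from continuous_attains_sup[OF compact_Icc _ this] show ?thesis using that by auto
  qed
  define m where "m = \<bar>u s\<bar>"
  have hb: "\<bar>h t\<bar> \<le> 2 * (\<alpha> * \<alpha>) + 5 * (\<mu> * m) + 42 * k" if t: "0 \<le> t" "t \<le> 7" for t
  proof -
    have um: "\<bar>u t\<bar> \<le> m" using sup[OF t] by (simp add: m_def)
    have "\<bar>X t - Y t\<bar> \<le> m + 14 * \<alpha>" using XY[of t] yX[OF t] um by linarith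
    then have "\<mu> * \<bar>X t - Y t\<bar> \<le> \<mu> * (m + 14 * \<alpha>)" using mu by (intro mult_left_mono) auto
    also have "\<dots> = \<mu> * m + 14 * k" by (simp add: k_def algebra_simps)
    finally have "\<bar>F (X t) - F (Y t)\<bar> \<le> 3 * (\<mu> * m + 14 * k)"
      by (rule order_trans[OF Fl[OF bX[OF t(1)] bY[OF t(1)]] mult_left_mono]) simp
    from abs_mult_bound[OF this bY[OF t(1)]]
    have 1: "\<bar>(F (X t) - F (Y t)) * Y t\<bar> \<le> 3 * (\<mu> * m + 14 * k)" by simp
    have 2: "\<bar>F (X t) * u t\<bar> \<le> 2 * \<mu> * m" by (rule abs_mult_bound[OF Fb[OF bX[OF t(1)]] um])
    have 3: "\<bar>\<alpha> * \<alpha> * y t\<bar> \<le> \<alpha> * \<alpha> * 2" by (rule abs_mult_bound[OF _ yb[OF t]]) simp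
    have "\<bar>h t\<bar> \<le> \<bar>\<alpha> * \<alpha> * y t\<bar> + \<bar>F (X t) * u t\<bar> + \<bar>(F (X t) - F (Y t)) * Y t\<bar>"
      unfolding h_def by linarith
    with 1 2 3 show ?thesis by (simp add: algebra_simps)
  qed
  have ub: "\<bar>u t - \<alpha> * sin t\<bar> \<le> 14 * (2 * (\<alpha> * \<alpha>) + 5 * (\<mu> * m) + 42 * k)" (is "_ \<le> 14 * ?H")
    if t: "0 \<le> t" "t \<le> 7" for t
  proof -
    have "\<bar>u t - (u 0 * cos t + p 0 * sin t)\<bar> \<le> 2 * (?H * t)"
      by (rule forced_oscillator_deviation[OF du dp]) (use hb t in auto)
    moreover have "0 \<le> ?H" using hb[OF t] by linarith
    then have "?H * t \<le> ?H * 7" using t by (intro mult_left_mono) auto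
    ultimately show ?thesis unfolding init' by simp
  qed
  have m3: "m \<le> 3 * \<alpha>"
  proof -
    have "\<bar>\<alpha> * sin s\<bar> \<le> \<alpha> * 1" using al by (intro abs_mult_bound) auto
    moreover have "m \<le> \<bar>u s - \<alpha> * sin s\<bar> + \<bar>\<alpha> * sin s\<bar>" by (simp add: m_def)
    moreover have "\<mu> * m \<le> 1 / 1000000 * m" using mu1 by (intro mult_right_mono) (auto simp: m_def)
    moreover have "k \<le> 1 / 1000000 * \<alpha>" unfolding k_def using mu1 al by (intro mult_right_mono) auto
    moreover have "m \<le> 3 * \<alpha>"
      if "C \<le> \<alpha> * 1" "m \<le> B + C" "Q \<le> 1 / 1000000 * m" "k \<le> 1 / 1000000 * \<alpha>"
        "B \<le> 14 * (2 * S + 5 * Q + 42 * k)" "S \<le> k" for B C Q S :: real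
      using that al by (simp add: algebra_simps)
    ultimately show ?thesis using ub[OF s] aak by blast
  qed
  have um: "\<bar>u t\<bar> \<le> 3 * \<alpha>" if "0 \<le> t" "t \<le> 7" for t
    using sup[OF that] m3 by (simp add: m_def)
  have uz: "\<bar>u t - \<alpha> * sin t\<bar> \<le> 826 * k" if t: "0 \<le> t" "t \<le> 7" for t
  proof -
    have "\<mu> * m \<le> \<mu> * (3 * \<alpha>)" using m3 mu by (intro mult_left_mono) auto
    then have "\<mu> * m \<le> 3 * k" by (simp add: k_def)
    then have "14 * (2 * (\<alpha> * \<alpha>) + 5 * (\<mu> * m) + 42 * k) \<le> 826 * k" using aak by (simp add: algebra_simps)
    with ub[OF t] show ?thesis by (rule order_trans)
  qed

  \<comment> \<open>\<open>d0\<close> is the first-order effect of the damping on the position: the derivative at \<open>\<alpha> = 0\<close> of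
    \<open>exp (- \<alpha> t) (cos t + \<alpha> sin t)\<close>, times \<open>\<alpha>\<close>.\<close>
  define d0 where "d0 t = \<alpha> * (sin t - t * cos t)" for t
  have d0b: "\<bar>d0 t\<bar> \<le> 8 * \<alpha>" if t: "0 \<le> t" "t \<le> 7" for t
  proof -
    have "\<bar>t * cos t\<bar> \<le> 7 * 1" using t by (intro abs_mult_bound) auto
    then have "\<bar>sin t - t * cos t\<bar> \<le> 8" using abs_sin_le_one[of t] by linarith
    then have "\<bar>\<alpha> * (sin t - t * cos t)\<bar> \<le> \<alpha> * 8" using al by (intro abs_mult_bound) auto
    then show ?thesis by (simp add: d0_def)
  qed
  have XYb: "\<bar>X t - Y t\<bar> \<le> 17 * \<alpha>" if "0 \<le> t" "t \<le> 7" for t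
    using XY[of t] yX[OF that] um[OF that] by linarith
  have XY0: "\<bar>X t - Y t - d0 t\<bar> \<le> 1190 * k" if t: "0 \<le> t" "t \<le> 7" for t
  proof -
    have at: "\<bar>\<alpha> * t\<bar> \<le> 7 * \<alpha>" using t al by simp
    have "\<bar>(Y t - cos t) * (\<alpha> * t)\<bar> \<le> 28 * \<mu> * (7 * \<alpha>)" by (rule abs_mult_bound[OF Yc[OF t] at])
    then have 1: "\<bar>(Y t - cos t) * (\<alpha> * t)\<bar> \<le> 196 * k" by (simp add: k_def)
    have "\<bar>(X t - Y t) * (\<alpha> * t)\<bar> \<le> 17 * \<alpha> * (7 * \<alpha>)" by (rule abs_mult_bound[OF XYb[OF t] at])
    then have 2: "\<bar>(X t - Y t) * (\<alpha> * t)\<bar> \<le> 119 * (\<alpha> * \<alpha>)" by simp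
    have 3: "\<bar>X t * (E t - 1 - \<alpha> * t)\<bar> \<le> 1 * (49 * (\<alpha> * \<alpha>))"
      using Eb(2,3)[OF t] by (intro abs_mult_bound bX t) auto
    have "X t - Y t - d0 t = (u t - \<alpha> * sin t) - X t * (E t - 1 - \<alpha> * t)
        - (Y t - cos t) * (\<alpha> * t) - (X t - Y t) * (\<alpha> * t)"
      unfolding XY d0_def by (simp add: u_def y_def algebra_simps)
    then show ?thesis using uz[OF t] 1 2 3 aak by linarith
  qed

  \<comment> \<open>\<open>Z\<close> is the leading term of \<open>F Y - F X\<close>.\<close>
  define Z where "Z t = 2 * \<mu> * (cos t * d0 t)" for t
  have Zb: "\<bar>Z t\<bar> \<le> 16 * k" if t: "0 \<le> t" "t \<le> 7" for t
  proof -
    have "\<bar>cos t * d0 t\<bar> \<le> 1 * (8 * \<alpha>)" by (intro abs_mult_bound d0b t) auto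
    then have "\<bar>2 * \<mu> * (cos t * d0 t)\<bar> \<le> 2 * \<mu> * (1 * (8 * \<alpha>))"
      by (rule abs_mult_bound[rotated]) (use mu in simp)
    then show ?thesis by (simp add: Z_def k_def)
  qed
  have Fdiff: "\<bar>F (X t) - F (Y t) + Z t\<bar> \<le> 3638 * (\<eta> * k)" if t: "0 \<le> t" "t \<le> 7" for t
  proof -
    have "\<mu> * \<bar>X t - Y t\<bar> \<le> \<mu> * (17 * \<alpha>)" using XYb[OF t] mu by (intro mult_left_mono) auto
    then have "\<eta> * (\<mu> * \<bar>X t - Y t\<bar>) \<le> \<eta> * (\<mu> * (17 * \<alpha>))"
      by (rule mult_left_mono) (use eta0 in simp)
    then have 1: "\<bar>F (X t) - F (Y t) + \<mu> * ((X t)\<^sup>2 - (Y t)\<^sup>2)\<bar> \<le> 17 * (\<eta> * k)"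
      using order_trans[OF F[OF bX[OF t(1)] bY[OF t(1)]]] by (simp add: k_def mult_ac)
    have 2: "\<bar>cos t * (X t - Y t - d0 t)\<bar> \<le> 1 * (1190 * k)" by (intro abs_mult_bound XY0 t) auto
    have "\<bar>(Y t - cos t) * (X t - Y t)\<bar> \<le> 28 * \<mu> * (17 * \<alpha>)" by (intro abs_mult_bound Yc XYb t)
    then have 3: "\<bar>(Y t - cos t) * (X t - Y t)\<bar> \<le> 476 * k" by (simp add: k_def)
    have "\<bar>(X t - Y t) * (X t - Y t)\<bar> \<le> 17 * \<alpha> * (17 * \<alpha>)" by (intro abs_mult_bound XYb t)
    then have 4: "\<bar>(X t - Y t) * (X t - Y t)\<bar> \<le> 289 * (\<alpha> * \<alpha>)" by simp
    define R where "R = 2 * (cos t * (X t - Y t - d0 t)) + 2 * ((Y t - cos t) * (X t - Y t))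
       + (X t - Y t) * (X t - Y t)"
    have "\<bar>R\<bar> \<le> 3621 * k" unfolding R_def using 2 3 4 aak by linarith
    then have "\<bar>\<mu> * R\<bar> \<le> \<mu> * (3621 * k)" using mu by (intro abs_mult_bound) auto
    then have 5: "\<bar>\<mu> * R\<bar> \<le> 3621 * (\<eta> * k)" using muk by linarith
    have "(X t)\<^sup>2 - (Y t)\<^sup>2 = 2 * (cos t * d0 t) + R"
      unfolding R_def by (simp add: power2_eq_square algebra_simps)
    then have "F (X t) - F (Y t) + Z t = (F (X t) - F (Y t) + \<mu> * ((X t)\<^sup>2 - (Y t)\<^sup>2)) - \<mu> * R"
      by (simp add: Z_def algebra_simps)
    with 1 5 show ?thesis by linarith
  qed

  define W where "W t = Y t * w t - y t * U t" for t
  have dW: "(W has_real_derivative (F (Y t) - F (X t) + \<alpha> * \<alpha>) * (y t * Y t)) (at t within {0..})"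
    if "0 \<le> t" for t
    unfolding W_def[abs_def]
    by (rule derivative_eq_intros dY dw dy dU that refl)+ (simp add: algebra_simps)
  have W'b: "(F (Y t) - F (X t) + \<alpha> * \<alpha>) * (y t * Y t) - Z t * (cos t)\<^sup>2 \<le> 8670 * (\<eta> * k)"
    if t: "0 \<le> t" "t \<le> 7" for t
  proof -
    have "\<bar>y t - cos t\<bar> \<le> 31 * \<mu>"
      using um[OF t] Yc[OF t] al(2) mu(1) by (simp add: u_def)
    then have 1: "\<bar>cos t * (y t - cos t)\<bar> \<le> 1 * (31 * \<mu>)" by (intro abs_mult_bound) auto
    have 2: "\<bar>y t * (Y t - cos t)\<bar> \<le> 2 * (28 * \<mu>)" by (intro abs_mult_bound yb Yc t)
    have "y t * Y t - (cos t)\<^sup>2 = y t * (Y t - cos t) + cos t * (y t - cos t)"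
      by (simp add: power2_eq_square algebra_simps)
    then have "\<bar>y t * Y t - (cos t)\<^sup>2\<bar> \<le> 87 * \<mu>" using 1 2 by linarith
    with Zb[OF t] have "\<bar>Z t * (y t * Y t - (cos t)\<^sup>2)\<bar> \<le> 16 * k * (87 * \<mu>)" by (rule abs_mult_bound)
    then have 3: "\<bar>Z t * (y t * Y t - (cos t)\<^sup>2)\<bar> \<le> 1392 * (\<eta> * k)" using muk by (simp add: mult.commute)
    have "\<bar>F (Y t) - F (X t) + \<alpha> * \<alpha> - Z t\<bar> \<le> 3639 * (\<eta> * k)"
      using Fdiff[OF t] aa by linarith
    moreover have "\<bar>y t * Y t\<bar> \<le> 2 * 1" by (intro abs_mult_bound yb bY t)
    ultimately have 4: "\<bar>(F (Y t) - F (X t) + \<alpha> * \<alpha> - Z t) * (y t * Y t)\<bar> \<le> 3639 * (\<eta> * k) * (2 * 1)"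
      by (rule abs_mult_bound)
    have "(F (Y t) - F (X t) + \<alpha> * \<alpha>) * (y t * Y t) - Z t * (cos t)\<^sup>2
      = (F (Y t) - F (X t) + \<alpha> * \<alpha> - Z t) * (y t * Y t) + Z t * (y t * Y t - (cos t)\<^sup>2)"
      by (simp add: algebra_simps)
    then show ?thesis using 3 4 by linarith
  qed

  \<comment> \<open>\<open>2 k G\<close> is a primitive of the leading term of \<open>W'\<close>.\<close>
  define P where "P t = 3 * t\<^sup>2 / 16 + t * sin (2 * t) / 4 + cos (2 * t) / 8 + t * sin (4 * t) / 32
      + cos (4 * t) / 128" for t :: real
  define G where "G t = - ((cos t) ^ 4 / 4) - P t" for t
  have dG: "(G has_real_derivative (cos t) ^ 3 * sin t - t * (cos t) ^ 4) (at t within {0..})" for t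
    unfolding G_def[abs_def] P_def
    by (rule DERIV_diff[OF _ quartic_cosine_primitive])
      (auto intro!: derivative_eq_intros simp: field_simps)
  have "(W T - 2 * k * G T) - (W 0 - 2 * k * G 0) \<le> 8670 * (\<eta> * k) * (T - 0)"
  proof (rule halfline_deriv_le[where D = "\<lambda>t. W t - 2 * k * G t"])
    show "((\<lambda>t. W t - 2 * k * G t) has_real_derivative (F (Y t) - F (X t) + \<alpha> * \<alpha>) * (y t * Y t)
       - 2 * k * ((cos t) ^ 3 * sin t - t * (cos t) ^ 4)) (at t within {0..})" if "0 \<le> t" for t
      by (intro DERIV_diff dW[OF that] DERIV_cmult dG)
    have "2 * k * ((cos t) ^ 3 * sin t - t * (cos t) ^ 4) = Z t * (cos t)\<^sup>2" for t
      by (simp add: Z_def k_def d0_def power2_eq_square power3_eq_cube power4_eq_xxxx algebra_simps)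
    then show "(F (Y t) - F (X t) + \<alpha> * \<alpha>) * (y t * Y t) - 2 * k * ((cos t) ^ 3 * sin t - t * (cos t) ^ 4)
      \<le> 8670 * (\<eta> * k)" if "0 < t" "t < T" for t
      using W'b[of t] that T by simp
  qed (use T in auto)
  moreover have "8670 * (\<eta> * k) * (T - 0) \<le> 8670 * (\<eta> * k) * 7"
    using T eta0 k0 by (intro mult_left_mono) auto
  moreover have "W 0 = \<alpha>" "W T = w T" using init init' T by (simp_all add: W_def)
  moreover have "2 * k * G T - 2 * k * G 0 \<le> - (8 * k)"
  proof -
    \<comment> \<open>The quadratic term of \<open>P\<close>, which comes from the secular growth of \<open>X - Y\<close>, dominates all periodic terms.\<close>
    have TT: "27 / 4 \<le> 3 * T\<^sup>2 / 16" using power_mono[OF T(1), of 2] by simp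
    have "\<bar>T * sin (2 * T)\<bar> \<le> 7 * 1" "\<bar>T * sin (4 * T)\<bar> \<le> 7 * 1"
      using T by (intro abs_mult_bound; simp)+
    moreover have "\<bar>cos (2 * T)\<bar> \<le> 1" "\<bar>cos (4 * T)\<bar> \<le> 1" by simp_all
    ultimately have "4 + 137/256 \<le> P T" using TT unfolding P_def by linarith
    moreover have "G 0 = - 1 / 4 - 17 / 128" by (simp add: G_def P_def)
    moreover have "0 \<le> (cos T) ^ 4" by simp
    ultimately have "G T - G 0 \<le> - 4" unfolding G_def[of T] by linarith
    then have "2 * k * (G T - G 0) \<le> 2 * k * (- 4)" using k0 by (intro mult_left_mono) auto
    then show ?thesis by (simp add: algebra_simps)
  qed
  moreover have "w1 \<le> \<alpha> - 7 * k"
    if "w1 - g1 - (\<alpha> - g0) \<le> Q" "Q \<le> 8670 * N * 7" "g1 - g0 \<le> - (8 * k)" "N \<le> k / 1000000"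
    for w1 g1 g0 Q N :: real
    using that k0 by linarith
  ultimately have wT: "w T \<le> \<alpha> - 7 * k" using etak by metis
  have "\<bar>u T\<bar> \<le> 3 * \<alpha>" using um T by simp
  then have "1 - 3 * \<alpha> \<le> y T" using T(3) by (simp add: u_def abs_le_iff)
  then have "\<alpha> * (1 - 3 * \<alpha>) \<le> \<alpha> * y T" using al by (intro mult_left_mono) auto
  then have "\<alpha> - 3 * (\<alpha> * \<alpha>) \<le> \<alpha> * y T" by (simp add: algebra_simps)
  then have "w T - \<alpha> * y T < 0" using wT aak k0 by linarith
  moreover have "w T - \<alpha> * y T = E T * V T" by (simp add: w_def y_def algebra_simps)
  ultimately have "E T * V T < 0" by simp
  then show "V T < 0" by (simp add: E_def mult_less_0_iff)
qed

section \<open>The oscillation time as a function of the damping\<close>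

lemma pi_ge_3: "3 \<le> pi"
  using sin_x_le_x[of "pi / 6"] by (simp add: sin_30)

lemma pi_le_16_5: "pi \<le> 16 / 5"
proof -
  have "arctan x \<le> x" if x: "0 \<le> x" for x :: real
  proof -
    have "arctan x - arctan 0 \<le> 1 * (x - 0)"
      by (rule halfline_deriv_le[OF has_field_derivative_at_within[OF DERIV_arctan]])
        (use x in \<open>auto simp: inverse_le_1_iff\<close>)
    then show ?thesis by simp
  qed
  from this[of "1/5"] have "arctan (1/5) \<le> 1/5" by simp
  moreover have "0 \<le> arctan (1 / 239)" by simp
  ultimately show ?thesis using machin by linarith
qed

context softening_spring begin

lemma osc_time_props:
  assumes b: "0 < b" "b < \<delta>" and al: "0 \<le> \<alpha>" "\<alpha> < 1" and m: "pendulum_motion f b \<alpha> x v \<theta>"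
  shows "0 < osc_time f b \<alpha>" "\<theta> (osc_time f b \<alpha>) = 2 * pi"
    "\<And>t. 0 \<le> t \<Longrightarrow> t < osc_time f b \<alpha> \<Longrightarrow> \<theta> t < 2 * pi"
    "\<And>t. osc_time f b \<alpha> < t \<Longrightarrow> 2 * pi < \<theta> t"
    "is_osc_time f b \<alpha> T \<longleftrightarrow> T = osc_time f b \<alpha>"
proof -
  obtain T where T: "T > 0" "\<theta> T = 2 * pi" "\<forall>t. 0 \<le> t \<longrightarrow> t < T \<longrightarrow> \<theta> t < 2 * pi" "\<forall>t>T. 2 * pi < \<theta> t"
    "\<forall>T'. is_osc_time f b \<alpha> T' \<longleftrightarrow> T' = T"
    using motion_osc_time[OF assms] by blast
  have "osc_time f b \<alpha> = T" unfolding osc_time_def by (rule the_equality) (use T(5) in auto)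
  with T show "0 < osc_time f b \<alpha>" "\<theta> (osc_time f b \<alpha>) = 2 * pi"
    "\<And>t. 0 \<le> t \<Longrightarrow> t < osc_time f b \<alpha> \<Longrightarrow> \<theta> t < 2 * pi"
    "\<And>t. osc_time f b \<alpha> < t \<Longrightarrow> 2 * pi < \<theta> t"
    "is_osc_time f b \<alpha> T \<longleftrightarrow> T = osc_time f b \<alpha>" for T by auto
qed

text \<open>
  Without damping the energy is constant, so the motion comes back exactly to its initial amplitude. The comparison
  with the damped motion needs this: an error in \<open>Y T\<close> would enter without a factor \<open>\<alpha>\<close>.
\<close>

lemma undamped_motion_returns:
  assumes b: "0 < b" "b < \<delta>" and m: "pendulum_motion f b 0 y w \<phi>"
    and T: "0 \<le> T" "w T = 0" "0 < y T"
  shows "y T = b"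
proof (rule ccontr)
  assume "y T \<noteq> b"
  with motionD(7)[OF m T(1)] have lt: "y T < b" by simp
  define g where "g z = z * (1 + f z)" for z
  have "continuous_on UNIV g" unfolding g_def[abs_def] by (intro continuous_intros f_cont)
  then obtain K where K: "\<And>z. (K has_real_derivative g z) (at z)"
    using antiderivative_exists[of g] by blast
  have "K (y T) < K b"
  proof (rule DERIV_pos_imp_increasing[OF lt])
    show "\<exists>l. (K has_real_derivative l) (at z) \<and> 0 < l" if "y T \<le> z" "z \<le> b" for z
      using K[of z] force_pos[of z] that b T by (intro exI[of _ "g z"]) (simp add: g_def)
  qed
  moreover have "\<bar>((w T)\<^sup>2 / 2 + K (y T)) - ((w 0)\<^sup>2 / 2 + K (y 0))\<bar> \<le> 0 * (T - 0)"
  proof (rule halfline_deriv_abs[where D = "\<lambda>t. (w t)\<^sup>2 / 2 + K (y t)"])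
    fix u :: real assume u: "0 \<le> u"
    show "((\<lambda>t. (w t)\<^sup>2 / 2 + K (y t)) has_real_derivative
        w u * (- (2 * 0 * w u) - y u * (1 + f (y u))) + w u * g (y u)) (at u within {0..})"
      by (rule derivative_eq_intros DERIV_chain'[OF motionD(4)[OF m u] K] motionD(5)[OF m u] refl | simp)+
  qed (use T in \<open>auto simp: g_def algebra_simps\<close>)
  ultimately show False using T motionD(1,2)[OF m] by simp
qed

lemma angle_near_time:
  assumes b: "0 < b" "b < \<delta>" and al: "0 \<le> \<alpha>" and m: "pendulum_motion f b \<alpha> x v \<theta>" and t: "0 \<le> t"
  shows "\<bar>\<theta> t - t\<bar> \<le> (\<alpha> + 2 * \<eta>) * t"
proof -
  have "\<bar>(\<theta> t - t) - (\<theta> 0 - 0)\<bar> \<le> (\<alpha> + 2 * \<eta>) * (t - 0)"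
  proof (rule halfline_deriv_abs[where D = "\<lambda>t. \<theta> t - t"])
    fix u :: real
    show "((\<lambda>t. \<theta> t - t) has_real_derivative
      1 - \<alpha> * sin (2 * \<theta> u) + f (x u) * (cos (\<theta> u))\<^sup>2 - 1) (at u within {0..})" if "0 \<le> u"
      by (intro DERIV_diff motionD(6)[OF m that] DERIV_ident)
    assume u: "0 < u"
    have "\<bar>f (x u)\<bar> \<le> 2 * \<eta>" using motionD(7)[OF m, of u] u b by (intro f_bounds) simp
    then have "\<bar>f (x u) * (cos (\<theta> u))\<^sup>2\<bar> \<le> 2 * \<eta> * 1"
      by (rule abs_mult_bound) (simp add: abs_square_le_1)
    moreover have "\<bar>\<alpha> * sin (2 * \<theta> u)\<bar> \<le> \<alpha> * 1" using al by (intro abs_mult_bound) auto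
    ultimately show "\<bar>1 - \<alpha> * sin (2 * \<theta> u) + f (x u) * (cos (\<theta> u))\<^sup>2 - 1\<bar> \<le> \<alpha> + 2 * \<eta>"
      by linarith
  qed (use t in auto)
  then show ?thesis using motionD(3)[OF m] by simp
qed

text \<open>
  At the undamped period \<open>T\<close>, the damped motion already has negative velocity, so \<open>sin \<theta> > 0\<close>. Its angle is still
  close to \<open>T\<close>, hence to \<open>2 \<pi>\<close>, so it must lie beyond \<open>2 \<pi>\<close>.
\<close>

lemma weak_damping_shortens_osc_time:
  assumes b: "0 < b" "b < \<delta>"
  shows "\<exists>\<alpha>. 0 < \<alpha> \<and> \<alpha> < 1 \<and> osc_time f b \<alpha> < osc_time f b 0"
proof -
  define \<mu> where "\<mu> = a * b\<^sup>2"
  define \<alpha> where "\<alpha> = \<eta> * \<mu>"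
  define T where "T = osc_time f b 0"
  have mu: "0 < \<mu>" "\<mu> \<le> \<eta>" using a_pos b a_sq_le[of b] by (auto simp: \<mu>_def)
  have al: "0 < \<alpha>" "\<alpha> \<le> \<eta>"
  proof -
    show "0 < \<alpha>" using eta mu by (simp add: \<alpha>_def)
    have "\<eta> * \<mu> \<le> \<eta> * 1" using eta mu by (intro mult_left_mono) auto
    then show "\<alpha> \<le> \<eta>" by (simp add: \<alpha>_def)
  qed
  then have al1: "0 \<le> \<alpha>" "\<alpha> < 1" using eta by auto
  obtain x v \<theta> where m: "pendulum_motion f b \<alpha> x v \<theta>"
    using motion_exists[OF b, of \<alpha>] al1 by fastforce
  obtain y w \<phi> where m0: "pendulum_motion f b 0 y w \<phi>"
    using motion_exists[OF b, of 0] by fastforce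
  have T: "0 < T" "\<phi> T = 2 * pi"
    using osc_time_props[OF b _ _ m0] by (auto simp: T_def)
  have "\<bar>\<phi> T - T\<bar> \<le> (0 + 2 * \<eta>) * T" by (rule angle_near_time[OF b _ m0]) (use T in auto)
  moreover have "(0 + 2 * \<eta>) * T \<le> 1 / 500000 * T" using eta T by (intro mult_right_mono) auto
  ultimately have T7: "T \<le> 7" using T pi_le_16_5 by linarith
  have T6: "6 \<le> T"
  proof -
    have "\<phi> T - \<phi> 0 \<le> 1 * (T - 0)"
    proof (rule halfline_deriv_le[OF motionD(6)[OF m0]])
      fix u :: real assume "0 < u"
      then have "f (y u) \<le> 0" using motionD(7)[OF m0, of u] b by (intro f_bounds) simp
      then have "f (y u) * (cos (\<phi> u))\<^sup>2 \<le> 0" by (simp add: mult_nonpos_nonneg)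
      then show "1 - 0 * sin (2 * \<phi> u) + f (y u) * (cos (\<phi> u))\<^sup>2 \<le> 1" by simp
    qed (use T in auto)
    then show ?thesis using T motionD(3)[OF m0] pi_ge_3 by simp
  qed
  obtain r where r: "0 < r" "y T = r * cos (\<phi> T)" "w T = - (r * sin (\<phi> T))"
    using motionD(8)[OF m0, of T] T by auto
  then have wT: "w T = 0" and "0 < y T" unfolding T by simp_all
  then have yT: "y T = b" using undamped_motion_returns[OF b m0] T by simp
  have bne: "b \<noteq> 0" using b by simp
  have "v T / b < 0"
  proof (rule damping_advances_phase[where X = "\<lambda>t. x t / b" and V = "\<lambda>t. v t / b" and T = T and Y = "\<lambda>t. y t / b" and U = "\<lambda>t. w t / b"
        and F = "\<lambda>z. f (b * z)" and \<mu> = \<mu> and \<eta> = \<eta> and \<alpha> = \<alpha>])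
    fix t :: real assume t: "0 \<le> t"
    show "((\<lambda>t. x t / b) has_real_derivative v t / b) (at t within {0..})"
      "((\<lambda>t. y t / b) has_real_derivative w t / b) (at t within {0..})"
      by (intro DERIV_cdivide motionD(4)[OF m t] motionD(4)[OF m0 t])+
    show "((\<lambda>t. v t / b) has_real_derivative - (2 * \<alpha> * (v t / b)) - x t / b * (1 + f (b * (x t / b)))) (at t within {0..})"
      by (rule DERIV_cong[OF DERIV_cdivide[OF motionD(5)[OF m t]]]) (use bne in \<open>simp add: field_simps\<close>)
    show "((\<lambda>t. w t / b) has_real_derivative - (y t / b * (1 + f (b * (y t / b))))) (at t within {0..})"
      by (rule DERIV_cong[OF DERIV_cdivide[OF motionD(5)[OF m0 t]]]) (use bne in \<open>simp add: field_simps\<close>)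
    show "\<bar>x t / b\<bar> \<le> 1" "\<bar>y t / b\<bar> \<le> 1"
      using motionD(7)[OF m t] motionD(7)[OF m0 t] b by (simp_all add: abs_divide)
  next
    fix p q :: real assume pq: "\<bar>p\<bar> \<le> 1" "\<bar>q\<bar> \<le> 1"
    have "\<bar>b * p\<bar> \<le> b" "\<bar>b * q\<bar> \<le> b" using pq b by (simp_all add: abs_mult)
    note fd = f_diff[OF this b(2)]
    have "\<bar>b * p - b * q\<bar> = b * \<bar>p - q\<bar>"
      using b by (simp add: right_diff_distrib[symmetric] abs_mult)
    moreover have "a * ((b * p)\<^sup>2 - (b * q)\<^sup>2) = \<mu> * (p\<^sup>2 - q\<^sup>2)"
      by (simp add: \<mu>_def power_mult_distrib algebra_simps)
    moreover have "a * b * (b * \<bar>p - q\<bar>) = \<mu> * \<bar>p - q\<bar>"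
      by (simp add: \<mu>_def power2_eq_square mult_ac)
    ultimately show "\<bar>f (b * p) - f (b * q) + \<mu> * (p\<^sup>2 - q\<^sup>2)\<bar> \<le> \<eta> * (\<mu> * \<bar>p - q\<bar>)"
      using fd by metis
  qed (use motionD(1,2)[OF m] motionD(1,2)[OF m0] f_zero mu eta T6 T7 yT wT bne in \<open>simp_all add: \<alpha>_def\<close>)
  then have vT: "v T < 0" using b by (simp add: divide_less_0_iff)
  have "2 * pi < \<theta> T"
  proof (rule ccontr)
    assume le: "\<not> 2 * pi < \<theta> T"
    have "\<bar>\<theta> T - T\<bar> \<le> (\<alpha> + 2 * \<eta>) * T" by (rule angle_near_time[OF b al1(1) m]) (use T in simp)
    also have "\<dots> \<le> 3 / 1000000 * 7" using al eta T T7 by (intro mult_mono) auto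
    finally have "pi < \<theta> T" using T6 pi_le_16_5 by linarith
    then have "sin (\<theta> T) \<le> 0"
      using le sin_lt_zero[of "\<theta> T"] by (cases "\<theta> T = 2 * pi") auto
    moreover obtain r where "0 < r" "v T = - (r * sin (\<theta> T))"
      using motionD(8)[OF m, of T] T by auto
    ultimately show False using vT by (simp add: mult_nonneg_nonpos zero_less_mult_iff not_less)
  qed
  then have "osc_time f b \<alpha> < T"
    using osc_time_props(2,3)[OF b al1 m] T by (metis less_imp_le linorder_less_linear order_less_asym)
  then show ?thesis using al al1 by (auto simp: T_def)
qed

text \<open>
  Just before and just after \<open>T = \<tau>(\<alpha>)\<close> the angle is strictly below and strictly above \<open>2 \<pi>\<close>. This persists for nearby
  damping coefficients and traps their oscillation times.
\<close>

lemma osc_time_continuous: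
  assumes b: "0 < b" "b < \<delta>"
  shows "continuous_on {0..<1} (osc_time f b)"
  unfolding continuous_on_iff
proof (intro ballI allI impI)
  fix \<alpha> e :: real assume al: "\<alpha> \<in> {0..<1}" and e: "0 < e"
  obtain x v \<theta> where m: "pendulum_motion f b \<alpha> x v \<theta>"
    using motion_exists[OF b, of \<alpha>] al by fastforce
  define T where "T = osc_time f b \<alpha>"
  have T: "0 < T" using osc_time_props(1)[OF b _ _ m] al by (simp add: T_def)
  define h where "h = min (e / 2) (T / 2)"
  have h: "0 < h" "h < e" "h < T" using e T by (auto simp: h_def min_def)
  have g1: "0 < 2 * pi - \<theta> (T - h)" and g2: "0 < \<theta> (T + h) - 2 * pi"
    using osc_time_props(3,4)[OF b _ _ m] al h by (auto simp: T_def)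
  have lip: "\<exists>C>0. \<forall>\<beta> y w \<phi>. 0 \<le> \<beta> \<longrightarrow> \<beta> < 1 \<longrightarrow> pendulum_motion f b \<beta> y w \<phi> \<longrightarrow> \<bar>\<theta> t - \<phi> t\<bar> \<le> C * \<bar>\<alpha> - \<beta>\<bar>"
    if t: "0 \<le> t" for t
  proof -
    obtain C where C: "\<forall>\<alpha> \<beta> x v \<theta> y w \<phi>. 0 \<le> \<alpha> \<longrightarrow> \<alpha> \<le> 1 \<longrightarrow> 0 \<le> \<beta> \<longrightarrow> \<beta> \<le> 1 \<longrightarrow>
      pendulum_motion f b \<alpha> x v \<theta> \<longrightarrow> pendulum_motion f b \<beta> y w \<phi> \<longrightarrow>
      \<bar>x t - y t\<bar> \<le> C * \<bar>\<alpha> - \<beta>\<bar> \<and> \<bar>\<theta> t - \<phi> t\<bar> \<le> C * \<bar>\<alpha> - \<beta>\<bar>"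
      using motion_lipschitz_in_damping[OF b t] ..
    show ?thesis
    proof (intro exI[of _ "\<bar>C\<bar> + 1"] conjI allI impI)
      fix \<beta> y w \<phi> assume be: "0 \<le> \<beta>" "\<beta> < 1" and m': "pendulum_motion f b \<beta> y w \<phi>"
      have "\<bar>\<theta> t - \<phi> t\<bar> \<le> C * \<bar>\<alpha> - \<beta>\<bar>"
        by (rule C[rule_format, THEN conjunct2, OF _ _ _ _ m m']) (use al be in auto)
      also have "\<dots> \<le> (\<bar>C\<bar> + 1) * \<bar>\<alpha> - \<beta>\<bar>" by (rule mult_right_mono) auto
      finally show "\<bar>\<theta> t - \<phi> t\<bar> \<le> (\<bar>C\<bar> + 1) * \<bar>\<alpha> - \<beta>\<bar>" .
    qed simp
  qed
  have t12: "0 \<le> T - h" "0 \<le> T + h" using h T by auto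
  obtain C1 where C1: "0 < C1" "\<And>\<beta> y w \<phi>. 0 \<le> \<beta> \<Longrightarrow> \<beta> < 1 \<Longrightarrow> pendulum_motion f b \<beta> y w \<phi> \<Longrightarrow>
      \<bar>\<theta> (T - h) - \<phi> (T - h)\<bar> \<le> C1 * \<bar>\<alpha> - \<beta>\<bar>"
    using lip[OF t12(1)] by (elim exE conjE) simp
  obtain C2 where C2: "0 < C2" "\<And>\<beta> y w \<phi>. 0 \<le> \<beta> \<Longrightarrow> \<beta> < 1 \<Longrightarrow> pendulum_motion f b \<beta> y w \<phi> \<Longrightarrow>
      \<bar>\<theta> (T + h) - \<phi> (T + h)\<bar> \<le> C2 * \<bar>\<alpha> - \<beta>\<bar>"
    using lip[OF t12(2)] by (elim exE conjE) simp
  define d where "d = min ((2 * pi - \<theta> (T - h)) / C1) ((\<theta> (T + h) - 2 * pi) / C2)"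
  have d: "0 < d" using g1 g2 C1(1) C2(1) by (simp add: d_def)
  show "\<exists>d>0. \<forall>\<beta>\<in>{0..<1}. dist \<beta> \<alpha> < d \<longrightarrow> dist (osc_time f b \<beta>) (osc_time f b \<alpha>) < e"
  proof (intro exI[of _ d] conjI ballI impI d)
    fix \<beta> :: real assume be: "\<beta> \<in> {0..<1}" and "dist \<beta> \<alpha> < d"
    then have close: "\<bar>\<alpha> - \<beta>\<bar> < (2 * pi - \<theta> (T - h)) / C1" "\<bar>\<alpha> - \<beta>\<bar> < (\<theta> (T + h) - 2 * pi) / C2"
      by (auto simp: d_def dist_real_def abs_minus_commute)
    obtain y w \<phi> where m': "pendulum_motion f b \<beta> y w \<phi>"
      using motion_exists[OF b, of \<beta>] be by fastforce
    have "\<bar>\<theta> (T - h) - \<phi> (T - h)\<bar> \<le> C1 * \<bar>\<alpha> - \<beta>\<bar>" using C1(2) m' be by simp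
    also have "\<dots> < 2 * pi - \<theta> (T - h)" using close(1) C1(1) by (simp add: pos_less_divide_eq mult.commute)
    finally have p1: "\<phi> (T - h) < 2 * pi" by linarith
    have "\<bar>\<theta> (T + h) - \<phi> (T + h)\<bar> \<le> C2 * \<bar>\<alpha> - \<beta>\<bar>" using C2(2) m' be by simp
    also have "\<dots> < \<theta> (T + h) - 2 * pi" using close(2) C2(1) by (simp add: pos_less_divide_eq mult.commute)
    finally have p2: "2 * pi < \<phi> (T + h)" by linarith
    have be': "0 \<le> \<beta>" "\<beta> < 1" using be by auto
    note P = osc_time_props[OF b be' m']
    have "T - h < osc_time f b \<beta>"
      using P(2) P(4)[of "T - h"] p1 by (cases "osc_time f b \<beta>" "T - h" rule: linorder_cases) auto
    moreover have "osc_time f b \<beta> < T + h"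
      using P(2) P(3)[of "T + h"] p2 t12 by (cases "osc_time f b \<beta>" "T + h" rule: linorder_cases) auto
    ultimately show "dist (osc_time f b \<beta>) (osc_time f b \<alpha>) < e"
      using h by (simp add: dist_real_def T_def)
  qed
qed

lemma osc_time_at_critical_damping:
  assumes b: "0 < b" "b < \<delta>"
  shows "filterlim (osc_time f b) at_top (at_left 1)"
proof (rule filterlim_at_top_mono)
  show "filterlim (\<lambda>\<alpha>. arctan (1 / 2) / (2 * sqrt (1 - \<alpha>))) at_top (at_left 1)"
  proof (rule LIM_at_top_divide[OF tendsto_const])
    have "((\<lambda>\<alpha>. 2 * sqrt (1 - \<alpha>)) \<longlongrightarrow> 2 * sqrt (1 - 1)) (at_left (1::real))"
      by (intro tendsto_intros)
    then show "((\<lambda>\<alpha>. 2 * sqrt (1 - \<alpha>)) \<longlongrightarrow> 0) (at_left (1::real))" by simp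
    show "\<forall>\<^sub>F \<alpha> in at_left (1::real). 0 < 2 * sqrt (1 - \<alpha>)"
      using eventually_at_left_real[of 0 1] by (auto elim!: eventually_mono)
  qed simp
  show "\<forall>\<^sub>F \<alpha> in at_left 1. arctan (1 / 2) / (2 * sqrt (1 - \<alpha>)) \<le> osc_time f b \<alpha>"
    using eventually_at_left_real[of 0 "1::real", OF zero_less_one]
  proof eventually_elim
    fix \<alpha> :: real assume "\<alpha> \<in> {0<..<1}"
    then have al: "0 \<le> \<alpha>" "\<alpha> < 1" by auto
    obtain x v \<theta> where m: "pendulum_motion f b \<alpha> x v \<theta>"
      using motion_exists[OF b, of \<alpha>] al by fastforce
    note P = osc_time_props[OF b al m]
    have "arctan (1 / 2) \<le> 2 * sqrt (1 - \<alpha>) * osc_time f b \<alpha>"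
      by (rule osc_time_lower_bound[OF b al m less_imp_le[OF P(1)] P(2)])
    then show "arctan (1 / 2) / (2 * sqrt (1 - \<alpha>)) \<le> osc_time f b \<alpha>"
      using al by (simp add: pos_divide_le_eq mult.commute)
  qed
qed

lemma osc_time_attains_minimum:
  assumes b: "0 < b" "b < \<delta>"
  shows "\<exists>\<alpha>. 0 < \<alpha> \<and> \<alpha> < 1 \<and> (\<forall>\<beta>. 0 < \<beta> \<and> \<beta> < 1 \<longrightarrow> osc_time f b \<alpha> \<le> osc_time f b \<beta>)"
proof -
  obtain \<gamma> where g: "0 < \<gamma>" "\<gamma> < 1" "osc_time f b \<gamma> < osc_time f b 0"
    using weak_damping_shortens_osc_time[OF b] by blast
  have "\<forall>\<^sub>F \<beta> in at_left 1. osc_time f b \<gamma> \<le> osc_time f b \<beta>"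
    using osc_time_at_critical_damping[OF b] by (simp add: filterlim_at_top)
  then obtain \<rho> where rho: "\<rho> < 1" "\<And>\<beta>. \<rho> < \<beta> \<Longrightarrow> \<beta> < 1 \<Longrightarrow> osc_time f b \<gamma> \<le> osc_time f b \<beta>"
    unfolding eventually_at_left_field by blast
  define \<sigma> where "\<sigma> = max \<rho> \<gamma>"
  have s: "\<rho> \<le> \<sigma>" "\<gamma> \<le> \<sigma>" "\<sigma> < 1" using rho g by (auto simp: \<sigma>_def)
  have "continuous_on {0..\<sigma>} (osc_time f b)"
    by (rule continuous_on_subset[OF osc_time_continuous[OF b]]) (use s in auto)
  then obtain \<alpha> where al: "\<alpha> \<in> {0..\<sigma>}" "\<And>\<beta>. \<beta> \<in> {0..\<sigma>} \<Longrightarrow> osc_time f b \<alpha> \<le> osc_time f b \<beta>"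
    using continuous_attains_inf[of "{0..\<sigma>}" "osc_time f b"] s g by auto
  have ag: "osc_time f b \<alpha> \<le> osc_time f b \<gamma>" using al(2)[of \<gamma>] g s by simp
  then have "\<alpha> \<noteq> 0" using g by auto
  moreover have "osc_time f b \<alpha> \<le> osc_time f b \<beta>" if "0 < \<beta>" "\<beta> < 1" for \<beta>
    using al(2)[of \<beta>] rho(2)[of \<beta>] ag that s by (cases "\<beta> \<le> \<sigma>") auto
  ultimately show ?thesis using al(1) s by (intro exI[of _ \<alpha>]) auto
qed

end

section \<open>From the Taylor expansion to the theorem\<close>

lemma second_derivative_zero_of_small:
  fixes e :: "real \<Rightarrow> real"
  assumes d1: "\<And>x. (e has_real_derivative e1 x) (at x)"
    and d2: "\<And>x. (e1 has_real_derivative e2 x) (at x)" and cont: "isCont e2 0"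
    and small: "\<forall>\<^sub>F x in nhds 0. \<bar>e x\<bar> \<le> C * \<bar>x\<bar> ^ 4"
  shows "e 0 = 0" "e1 0 = 0" "e2 0 = 0"
proof -
  show e0: "e 0 = 0" using eventually_nhds_x_imp_x[OF small] by simp
  have small0: "\<forall>\<^sub>F x in at 0. \<bar>e x\<bar> \<le> C * \<bar>x\<bar> ^ 4"
    using small by (simp add: eventually_at_filter eventually_mono)
  have "((\<lambda>x. (e x - e 0) / (x - 0)) \<longlongrightarrow> e1 0) (at 0)"
    using d1[of 0] by (simp add: has_field_derivative_iff)
  moreover have "((\<lambda>x. (e x - e 0) / (x - 0)) \<longlongrightarrow> 0) (at 0)"
  proof (rule Lim_null_comparison)
    show "\<forall>\<^sub>F x in at 0. norm ((e x - e 0) / (x - 0)) \<le> C * \<bar>x\<bar> ^ 3"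
      using small0 eventually_neq_at_within[of 0]
    proof eventually_elim
      fix x :: real assume x: "\<bar>e x\<bar> \<le> C * \<bar>x\<bar> ^ 4" "x \<noteq> 0"
      have "\<bar>e x\<bar> / \<bar>x\<bar> \<le> C * \<bar>x\<bar> ^ 4 / \<bar>x\<bar>" using x by (intro divide_right_mono) auto
      also have "\<dots> = C * \<bar>x\<bar> ^ 3" using x by (simp add: power4_eq_xxxx power3_eq_cube)
      finally show "norm ((e x - e 0) / (x - 0)) \<le> C * \<bar>x\<bar> ^ 3" by (simp add: e0)
    qed
    have "((\<lambda>x. C * \<bar>x\<bar> ^ 3) \<longlongrightarrow> C * \<bar>0\<bar> ^ 3) (at (0::real))" by (intro tendsto_intros)
    then show "((\<lambda>x. C * \<bar>x\<bar> ^ 3) \<longlongrightarrow> 0) (at (0::real))" by simp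
  qed
  ultimately show e10: "e1 0 = 0" by (intro LIM_unique[of _ _ 0])
  show "e2 0 = 0"
  proof (rule ccontr)
    assume "e2 0 \<noteq> 0"
    then have k: "0 < \<bar>e2 0\<bar> / 2" by simp
    have "(e2 \<longlongrightarrow> e2 0) (at 0)" using cont by (simp add: isCont_def)
    from tendstoD[OF this k] obtain d where d: "0 < d" "\<And>t. t \<noteq> 0 \<Longrightarrow> \<bar>t\<bar> < d \<Longrightarrow> \<bar>e2 t - e2 0\<bar> < \<bar>e2 0\<bar> / 2"
      unfolding eventually_at by (auto simp: dist_real_def)
    have "((\<lambda>x. 2 * C * x\<^sup>2) \<longlongrightarrow> 2 * C * 0\<^sup>2) (at_right (0::real))" by (intro tendsto_intros)
    then have "((\<lambda>x. 2 * C * x\<^sup>2) \<longlongrightarrow> 0) (at_right (0::real))" by simp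
    from order_tendstoD(2)[OF this k] have "\<forall>\<^sub>F x in at_right 0. 2 * C * x\<^sup>2 < \<bar>e2 0\<bar> / 2" .
    moreover have "\<forall>\<^sub>F x in at_right 0. \<bar>e x\<bar> \<le> C * \<bar>x\<bar> ^ 4"
      using small0 by (rule filter_leD[OF at_le, rotated]) simp
    moreover have "\<forall>\<^sub>F x in at_right 0. x \<in> {0<..<d}" using d(1) by (rule eventually_at_right_real)
    ultimately have "\<forall>\<^sub>F x in at_right 0. 2 * C * x\<^sup>2 < \<bar>e2 0\<bar> / 2 \<and> \<bar>e x\<bar> \<le> C * \<bar>x\<bar> ^ 4 \<and> x \<in> {0<..<d}"
      by eventually_elim auto
    then obtain h where h: "2 * C * h\<^sup>2 < \<bar>e2 0\<bar> / 2" "\<bar>e h\<bar> \<le> C * \<bar>h\<bar> ^ 4" "0 < h" "h < d"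
      using eventually_happens'[of "at_right (0::real)"] by (auto simp: trivial_limit_at_right_real)
    define D where "D m = (if m = 0 then e else if m = 1 then e1 else e2)" for m :: nat
    have "\<exists>t>0. t < h \<and> e h = (\<Sum>m<2. D m 0 / fact m * h ^ m) + D 2 t / fact 2 * h ^ 2"
      by (rule Maclaurin) (use h d1 d2 in \<open>auto simp: D_def less_2_cases_iff\<close>)
    then obtain t where t: "0 < t" "t < h" "e h = e2 t / 2 * h\<^sup>2"
      by (auto simp: D_def e0 e10 numeral_2_eq_2)
    have "\<bar>e2 t\<bar> * h\<^sup>2 = 2 * \<bar>e h\<bar>" unfolding t(3) by (simp add: abs_mult)
    also have "\<dots> \<le> (2 * C * h\<^sup>2) * h\<^sup>2" using h(2,3) by (simp add: power4_eq_xxxx power2_eq_square mult_ac)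
    finally have "\<bar>e2 t\<bar> \<le> 2 * C * h\<^sup>2" using h(3) by simp
    with h(1) have "\<bar>e2 t\<bar> < \<bar>e2 0\<bar> / 2" by (rule le_less_trans[rotated])
    moreover have "\<bar>e2 t - e2 0\<bar> < \<bar>e2 0\<bar> / 2" using d(2)[of t] t h(4) by simp
    ultimately show False using abs_triangle_ineq2[of "e2 0" "e2 t"] by (simp add: abs_minus_commute)
  qed
qed

text \<open>
  A bound \<open>O(x\<^sup>4)\<close> on \<open>e x = f x + a x\<^sup>2\<close> says nothing about its derivatives by itself, but \<open>e\<close> is smooth,
  so \<open>e\<close>, \<open>e'\<close> and \<open>e''\<close> vanish at \<open>0\<close>. Near \<open>0\<close> then \<open>\<bar>e''\<bar> \<le> \<eta> a\<close>, and two applications of the mean value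
  theorem give the Lipschitz estimate of the locale.
\<close>

lemma softening_spring_near_zero:
  fixes f :: "real \<Rightarrow> real" and a \<epsilon> :: real
  assumes sm: "smooth f" and eps: "\<epsilon> > 0"
    and even: "\<And>x. x \<in> {-\<epsilon><..<\<epsilon>} \<Longrightarrow> f (- x) = f x" and a: "a > 0"
    and O: "(\<lambda>x. f x - (- a * x ^ 2)) \<in> O[nhds 0](\<lambda>x. \<bar>x\<bar> ^ 4)"
    and eta: "0 < \<eta>" "\<eta> \<le> 1 / 1000000"
  shows "\<exists>\<delta>. softening_spring f a \<eta> \<delta>"
proof -
  define f1 where "f1 = deriv f"
  define f2 where "f2 = deriv f1"
  have df: "(f has_real_derivative f1 x) (at x)" for x
    using sm[unfolded smooth_def, rule_format, of 0 x]
    by (simp add: f1_def DERIV_deriv_iff_real_differentiable)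
  have df1: "(f1 has_real_derivative f2 x) (at x)" for x
    using sm[unfolded smooth_def, rule_format, of 1 x]
    by (simp add: f1_def f2_def DERIV_deriv_iff_real_differentiable)
  have "f2 differentiable (at x)" for x
    using sm[unfolded smooth_def, rule_format, of 2 x] by (simp add: f1_def f2_def numeral_2_eq_2)
  then have cf2: "isCont f2 x" for x
    by (simp add: differentiable_imp_continuous_within)
  define e where "e x = f x + a * x\<^sup>2" for x
  define e1 where "e1 x = f1 x + 2 * a * x" for x
  define e2 where "e2 x = f2 x + 2 * a" for x
  have de: "(e has_real_derivative e1 x) (at x)" for x
    unfolding e_def[abs_def] e1_def by (auto intro!: derivative_eq_intros df)
  have de1: "(e1 has_real_derivative e2 x) (at x)" for x
    unfolding e1_def[abs_def] e2_def by (auto intro!: derivative_eq_intros df1)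
  have ce2: "isCont e2 0" unfolding e2_def[abs_def] by (intro continuous_intros cf2)
  obtain C where "\<forall>\<^sub>F x in nhds 0. norm (f x - (- a * x ^ 2)) \<le> C * norm (\<bar>x\<bar> ^ 4)"
    using landau_o.bigE[OF O] by blast
  then have small: "\<forall>\<^sub>F x in nhds 0. \<bar>e x\<bar> \<le> C * \<bar>x\<bar> ^ 4" by (simp add: e_def)
  note z = second_derivative_zero_of_small[OF de de1 ce2 small]
  have "(e2 \<longlongrightarrow> 0) (at 0)" using ce2 z by (simp add: isCont_def)
  moreover have "0 < \<eta> * a" using eta a by simp
  ultimately obtain d where d: "0 < d" "\<And>t. t \<noteq> 0 \<Longrightarrow> \<bar>t\<bar> < d \<Longrightarrow> \<bar>e2 t\<bar> < \<eta> * a"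
    using tendstoD[of e2 0 "at 0" "\<eta> * a"] unfolding eventually_at by (auto simp: dist_real_def)
  have e2b: "\<bar>e2 t\<bar> \<le> \<eta> * a" if "\<bar>t\<bar> < d" for t
    using d(2)[of t] that z eta a by (cases "t = 0") auto
  define \<delta> where "\<delta> = min (min d \<epsilon>) (min 1 (\<eta> / a))"
  have del: "0 < \<delta>" "\<delta> \<le> d" "\<delta> \<le> \<epsilon>" "\<delta> \<le> 1" "\<delta> \<le> \<eta> / a"
    using d eps eta a by (auto simp: \<delta>_def)
  have "softening_spring f a \<eta> \<delta>"
  proof
    show "a * \<delta>\<^sup>2 \<le> \<eta>"
    proof -
      have "a * \<delta>\<^sup>2 \<le> a * (1 * \<delta>)"
        unfolding power2_eq_square using del a by (intro mult_left_mono mult_right_mono) auto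
      also have "\<dots> \<le> \<eta>" using del(5) a by (simp add: pos_le_divide_eq mult.commute)
      finally show ?thesis .
    qed
    show "f 0 = 0" using z by (simp add: e_def)
    show "continuous_on UNIV f" using df by (meson DERIV_continuous_on has_field_derivative_at_within)
    show "f (- x) = f x" if "\<bar>x\<bar> < \<delta>" for x using that del by (intro even) auto
    fix x y b :: real assume b: "\<bar>x\<bar> \<le> b" "\<bar>y\<bar> \<le> b" "b < \<delta>"
    have "norm (e x - e y) \<le> \<eta> * a * b * norm (x - y)"
    proof (rule field_differentiable_bound[where S = "{-b..b}" and f' = e1])
      show "(e has_real_derivative e1 w) (at w within {-b..b})" for w
        by (rule has_field_derivative_at_within[OF de])
      show "norm (e1 w) \<le> \<eta> * a * b" if w: "w \<in> {-b..b}" for w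
      proof -
        have "norm (e1 w - e1 0) \<le> \<eta> * a * norm (w - 0)"
        proof (rule field_differentiable_bound[where S = "{-b..b}" and f' = e2])
          show "(e1 has_real_derivative e2 u) (at u within {-b..b})" for u
            by (rule has_field_derivative_at_within[OF de1])
          show "norm (e2 u) \<le> \<eta> * a" if "u \<in> {-b..b}" for u
            using e2b[of u] that b del by auto
        qed (use w b in auto)
        also have "\<dots> \<le> \<eta> * a * b" using w eta a by (intro mult_left_mono) auto
        finally show ?thesis using z by simp
      qed
    qed (use b in auto)
    moreover have "e x - e y = f x - f y + a * (x\<^sup>2 - y\<^sup>2)" by (simp add: e_def algebra_simps)
    ultimately show "\<bar>f x - f y + a * (x\<^sup>2 - y\<^sup>2)\<bar> \<le> \<eta> * (a * b * \<bar>x - y\<bar>)" by (simp add: mult.assoc)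
  qed (use a eta del in auto)
  then show ?thesis ..
qed

theorem theorem3p1:
  fixes f :: "real \<Rightarrow> real" and a \<epsilon> :: real
  assumes "smooth f"
    and "\<epsilon> > 0"
    and "\<And>x. x \<in> {-\<epsilon><..<\<epsilon>} \<Longrightarrow> f (- x) = f x"
    and "a > 0"
    and "(\<lambda>x. f x - (- a * x ^ 2)) \<in> O[nhds 0](\<lambda>x. \<bar>x\<bar> ^ 4)"
  shows "\<exists>\<delta>>0. \<forall>x0. 0 < x0 \<and> x0 < \<delta> \<longrightarrow>
           (\<forall>\<alpha>. 0 \<le> \<alpha> \<and> \<alpha> < 1 \<longrightarrow>
              (\<exists>x. pendulum_solution f x0 \<alpha> x \<and>
                   (\<forall>y. pendulum_solution f x0 \<alpha> y \<longrightarrow> (\<forall>t\<ge>0. y t = x t))) \<and>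
              (\<exists>!T. is_osc_time f x0 \<alpha> T)) \<and>
           (\<exists>\<alpha>. 0 < \<alpha> \<and> \<alpha> < 1 \<and> 0 < osc_time f x0 \<alpha> \<and>
              (\<forall>\<beta>. 0 < \<beta> \<and> \<beta> < 1 \<longrightarrow> osc_time f x0 \<alpha> \<le> osc_time f x0 \<beta>)) \<and>
           filterlim (\<lambda>\<alpha>. osc_time f x0 \<alpha>) at_top (at_left 1)"
proof -
  obtain \<delta> where "softening_spring f a (1 / 1000000) \<delta>"
    using softening_spring_near_zero[OF assms, of "1 / 1000000"] by auto
  then interpret softening_spring f a "1 / 1000000" \<delta> .
  have unique_solution: "\<exists>x. pendulum_solution f x0 \<alpha> x \<and>
      (\<forall>y. pendulum_solution f x0 \<alpha> y \<longrightarrow> (\<forall>t\<ge>0. y t = x t))"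
    if "0 < x0" "x0 < \<delta>" "0 \<le> \<alpha>" "\<alpha> < 1" for x0 \<alpha>
    using solution_exists[OF that(1-3)] solution_unique[OF that(1-3)] that(4) by (meson less_imp_le)
  have unique_time: "\<exists>!T. is_osc_time f x0 \<alpha> T" and pos_time: "0 < osc_time f x0 \<alpha>"
    if b: "0 < x0" "x0 < \<delta>" and al: "0 \<le> \<alpha>" "\<alpha> < 1" for x0 \<alpha>
  proof -
    obtain x v \<theta> where m: "pendulum_motion f x0 \<alpha> x v \<theta>"
      using motion_exists[OF b al(1) less_imp_le[OF al(2)]] by blast
    show "0 < osc_time f x0 \<alpha>" by (rule osc_time_props(1)[OF b al m])
    show "\<exists>!T. is_osc_time f x0 \<alpha> T" by (simp add: osc_time_props(5)[OF b al m])
  qed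
  have minimum: "\<exists>\<alpha>. 0 < \<alpha> \<and> \<alpha> < 1 \<and> 0 < osc_time f x0 \<alpha> \<and>
      (\<forall>\<beta>. 0 < \<beta> \<and> \<beta> < 1 \<longrightarrow> osc_time f x0 \<alpha> \<le> osc_time f x0 \<beta>)" if "0 < x0" "x0 < \<delta>" for x0
    using osc_time_attains_minimum[OF that] pos_time[OF that] by (meson less_imp_le)
  show ?thesis
  proof (intro exI[of _ \<delta>] conjI[OF delta_pos] allI impI)
    fix x0 assume x0: "0 < x0 \<and> x0 < \<delta>"
    show "(\<forall>\<alpha>. 0 \<le> \<alpha> \<and> \<alpha> < 1 \<longrightarrow>
              (\<exists>x. pendulum_solution f x0 \<alpha> x \<and>
                   (\<forall>y. pendulum_solution f x0 \<alpha> y \<longrightarrow> (\<forall>t\<ge>0. y t = x t))) \<and>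
              (\<exists>!T. is_osc_time f x0 \<alpha> T)) \<and>
           (\<exists>\<alpha>. 0 < \<alpha> \<and> \<alpha> < 1 \<and> 0 < osc_time f x0 \<alpha> \<and>
              (\<forall>\<beta>. 0 < \<beta> \<and> \<beta> < 1 \<longrightarrow> osc_time f x0 \<alpha> \<le> osc_time f x0 \<beta>)) \<and>
           filterlim (\<lambda>\<alpha>. osc_time f x0 \<alpha>) at_top (at_left 1)"
      using x0 unique_solution[of x0] unique_time[of x0] minimum[of x0]
        osc_time_at_critical_damping[of x0] by (intro conjI allI impI) simp_all
  qed
qed

end
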